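(* Let $\mathcal{C}$ be the collection of all generalized shifts $\sigma_\psi:Y^\Gamma\to Y^\Gamma$ such that $Y$ is a nontrivial finite discrete topological group, $\Gamma$ is a nonempty set, and both maps $\psi:\Gamma\to\Gamma$ and $\sigma_\psi:Y^\Gamma\to Y^\Gamma$ are finite fibre. For $\sigma_\psi\in\mathcal{C}$ consider the four quantities $t=\mathrm{ent}_{\rm top}(\sigma_\psi)$, $a=\mathrm{ent}_{\rm alg}(\sigma_\psi\restriction_{\bigoplus_\Gamma Y})$, $c=\mathrm{ent}_{\rm cset}(\sigma_\psi)$, $s=\mathrm{ent}_{\rm set}(\sigma_\psi)$, where in every assertion involving $a$ the group $Y$ is taken to be abelian. Then: (i) for all elements of $\mathcal{C}$ one has $t\leq c$, $t\leq s$, $a\leq s$ and $c\leq s$ (and trivially $t\le t$, $a\le a$, $c\le c$, $s\le s$); (ii) for each of the following strict inequalities there exists an element of $\mathcal{C}$ satisfying it: $t>a$; $a>t$; $a>c$; $c>t$; $c>a$; $s>t$; $s>a$; $s>c$.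
   Context: The generalized shift of $\psi:\Gamma\to\Gamma$ is $\sigma_\psi((x_\alpha)_{\alpha\in\Gamma})=(x_{\psi(\alpha)})_{\alpha\in\Gamma}$. A map is finite fibre if the preimage of every point is finite. Set-theoretical entropy: for $g:A\to A$, $\mathrm{ent}_{\rm set}(g)=\sup_D\lim_{n\to\infty}\frac{|D\cup g(D)\cup\cdots\cup g^{n-1}(D)|}{n}$ over finite $D\subseteq A$. Contravariant set-theoretical entropy: for $g:A\to A$ onto and finite fibre, $\mathrm{ent}_{\rm cset}(g)=\sup_D\lim_{n\to\infty}\frac{|D\cup g^{-1}(D)\cup\cdots\cup g^{-(n-1)}(D)|}{n}$ over finite $D\subseteq A$; for an arbitrary finite fibre $k:A\to A$, $\mathrm{ent}_{\rm cset}(k):=\mathrm{ent}_{\rm cset}(k\restriction_{\mathrm{sc}(k)})$ where $\mathrm{sc}(k)=\bigcap\{k^n(A):n\geq1\}$ (on which $k$ restricts to an onto finite fibre self-map). Topological entropy: for a compact space $Z$ and continuous $T:Z\to Z$, $\mathrm{ent}_{\rm top}(T)=\sup_{\mathcal{U}}\lim_{n\to\infty}\frac{\log N(\mathcal{U}\vee T^{-1}(\mathcal{U})\vee\cdots\vee T^{-(n-1)}(\mathcal{U}))}{n}$ over finite open covers $\mathcal{U}$, where $\mathcal{U}\vee\mathcal{V}=\{U\cap V:U\in\mathcal{U},V\in\mathcal{V}\}$ and $N(\mathcal{U})$ is the minimal cardinality of a finite subcover of $\mathcal{U}$. Here $Y^\Gamma$ has the product topology. It is known that $\mathrm{ent}_{\rm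 top}(\sigma_\psi)=\mathrm{ent}_{\rm set}(\psi)\log|Y|$. Algebraic entropy: for an abelian group $G$ and endomorphism $\theta:G\to G$, $\mathrm{ent}_{\rm alg}(\theta)=\sup_H\lim_{n\to\infty}\frac{\log|H+\theta(H)+\cdots+\theta^{n-1}(H)|}{n}$ over finite subgroups $H$ of $G$. $\bigoplus_\Gamma Y$ is the subgroup of $Y^\Gamma$ of all families equal to the identity $e$ of $Y$ at all but finitely many indices; when $\psi$ is finite fibre it is mapped into itself by $\sigma_\psi$. It is known that for $\psi$ finite fibre, $\mathrm{ent}_{\rm alg}(\sigma_\psi\restriction_{\bigoplus_\Gamma Y})=\mathrm{ent}_{\rm cset}(\psi)\log|Y|$. *)

theory Defs
  imports "HOL-Analysis.Analysis" "HOL-Algebra.Product_Groups"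
begin

text \<open>All entropies are extended reals. Every map below is only relevant on an explicit carrier
  that it maps into itself. In each limit the term at \<open>n = 0\<close> is a division by zero
  and has no influence.\<close>

definition finite_fibre :: "'a set \<Rightarrow> ('a \<Rightarrow> 'b) \<Rightarrow> bool" where
  "finite_fibre A g \<longleftrightarrow> (\<forall>y. finite {x \<in> A. g x = y})"


definition ent_set :: "'a set \<Rightarrow> ('a \<Rightarrow> 'a) \<Rightarrow> ereal" where
  "ent_set A g = (SUP D \<in> {D. finite D \<and> D \<subseteq> A}.
     lim (\<lambda>n. ereal (real (card (\<Union>i<n. (g ^^ i) ` D)) / real n)))"


text \<open>\<open>ent_cset_onto\<close> is meant for finite fibre maps of \<open>A\<close> onto itself, \<open>ent_cset\<close> for
  arbitrary finite fibre self-maps.\<close>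

definition ent_cset_onto :: "'a set \<Rightarrow> ('a \<Rightarrow> 'a) \<Rightarrow> ereal" where
  "ent_cset_onto A g = (SUP D \<in> {D. finite D \<and> D \<subseteq> A}.
     lim (\<lambda>n. ereal (real (card (\<Union>i<n. {x \<in> A. (g ^^ i) x \<in> D})) / real n)))"

definition surjective_core :: "'a set \<Rightarrow> ('a \<Rightarrow> 'a) \<Rightarrow> 'a set" where
  "surjective_core A k = (\<Inter>n\<in>{1..}. (k ^^ n) ` A)"

definition ent_cset :: "'a set \<Rightarrow> ('a \<Rightarrow> 'a) \<Rightarrow> ereal" where
  "ent_cset A k = ent_cset_onto (surjective_core A k) k"


definition finite_open_cover :: "'a topology \<Rightarrow> 'a set set \<Rightarrow> bool" where
  "finite_open_cover X \<U> \<longleftrightarrow> finite \<U> \<and> (\<forall>U\<in>\<U>. openin X U) \<and> \<Union>\<U> = topspace X"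

definition cover_join :: "'a set set \<Rightarrow> 'a set set \<Rightarrow> 'a set set" where
  "cover_join \<U> \<V> = {U \<inter> V |U V. U \<in> \<U> \<and> V \<in> \<V>}"

definition cover_number :: "'a topology \<Rightarrow> 'a set set \<Rightarrow> nat" where
  "cover_number X \<U> = (LEAST k. \<exists>\<V>\<subseteq>\<U>. finite \<V> \<and> \<Union>\<V> = topspace X \<and> card \<V> = k)"

definition cover_preimage :: "'a topology \<Rightarrow> ('a \<Rightarrow> 'a) \<Rightarrow> 'a set set \<Rightarrow> 'a set set" where
  "cover_preimage X T \<U> = (\<lambda>U. {x \<in> topspace X. T x \<in> U}) ` \<U>"

text \<open>The join of \<open>T\<^sup>-\<^sup>i \<U>\<close> for \<open>i < n\<close>; the trivial cover is neutral for joins.\<close>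

primrec iterated_join :: "'a topology \<Rightarrow> ('a \<Rightarrow> 'a) \<Rightarrow> 'a set set \<Rightarrow> nat \<Rightarrow> 'a set set" where
  "iterated_join X T \<U> 0 = {topspace X}"
| "iterated_join X T \<U> (Suc n) =
     cover_join (iterated_join X T \<U> n) (cover_preimage X (T ^^ n) \<U>)"

definition ent_top :: "'a topology \<Rightarrow> ('a \<Rightarrow> 'a) \<Rightarrow> ereal" where
  "ent_top X T = (SUP \<U> \<in> {\<U>. finite_open_cover X \<U>}.
     lim (\<lambda>n. ereal (ln (real (cover_number X (iterated_join X T \<U> n))) / real n)))"


text \<open>The sum \<open>H + \<theta> H + \<dots> + \<theta>\<^sup>n\<^sup>-\<^sup>1 H\<close>, written multiplicatively.\<close>

primrec alg_trajectory :: "('a, 'b) monoid_scheme \<Rightarrow> ('a \<Rightarrow> 'a) \<Rightarrow> 'a set \<Rightarrow> nat \<Rightarrow> 'a set" where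
  "alg_trajectory G \<theta> H 0 = {\<one>\<^bsub>G\<^esub>}"
| "alg_trajectory G \<theta> H (Suc n) = alg_trajectory G \<theta> H n <#>\<^bsub>G\<^esub> (\<theta> ^^ n) ` H"

definition ent_alg :: "('a, 'b) monoid_scheme \<Rightarrow> ('a \<Rightarrow> 'a) \<Rightarrow> ereal" where
  "ent_alg G \<theta> = (SUP H \<in> {H. subgroup H G \<and> finite H}.
     lim (\<lambda>n. ereal (ln (real (card (alg_trajectory G \<theta> H n))) / real n)))"


text \<open>Points of \<open>Y\<^sup>\<Gamma>\<close> are the extensional functions \<open>\<Gamma> \<rightarrow>\<^sub>E carrier Y\<close>.\<close>

definition gen_shift :: "'i set \<Rightarrow> ('i \<Rightarrow> 'i) \<Rightarrow> ('i \<Rightarrow> 'y) \<Rightarrow> ('i \<Rightarrow> 'y)" where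
  "gen_shift \<Gamma> \<psi> x = (\<lambda>\<alpha>\<in>\<Gamma>. x (\<psi> \<alpha>))"

definition shift_class :: "('y, 'b) monoid_scheme \<Rightarrow> 'i set \<Rightarrow> ('i \<Rightarrow> 'i) \<Rightarrow> bool" where
  "shift_class Y \<Gamma> \<psi> \<longleftrightarrow>
     group Y \<and> finite (carrier Y) \<and> carrier Y \<noteq> {\<one>\<^bsub>Y\<^esub>} \<and>
     \<Gamma> \<noteq> {} \<and> \<psi> \<in> \<Gamma> \<rightarrow> \<Gamma> \<and> finite_fibre \<Gamma> \<psi> \<and>
     finite_fibre (\<Gamma> \<rightarrow>\<^sub>E carrier Y) (gen_shift \<Gamma> \<psi> :: ('i \<Rightarrow> 'y) \<Rightarrow> ('i \<Rightarrow> 'y))"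

definition shift_top :: "('y, 'b) monoid_scheme \<Rightarrow> 'i set \<Rightarrow> ('i \<Rightarrow> 'i) \<Rightarrow> ereal" where
  "shift_top Y \<Gamma> \<psi> =
     ent_top (product_topology (\<lambda>_. discrete_topology (carrier Y)) \<Gamma>) (gen_shift \<Gamma> \<psi>)"

definition shift_alg :: "('y, 'b) monoid_scheme \<Rightarrow> 'i set \<Rightarrow> ('i \<Rightarrow> 'i) \<Rightarrow> ereal" where
  "shift_alg Y \<Gamma> \<psi> = ent_alg (sum_group \<Gamma> (\<lambda>_. Y)) (gen_shift \<Gamma> \<psi>)"

definition shift_cset :: "('y, 'b) monoid_scheme \<Rightarrow> 'i set \<Rightarrow> ('i \<Rightarrow> 'i) \<Rightarrow> ereal" where
  "shift_cset Y \<Gamma> \<psi> = ent_cset (\<Gamma> \<rightarrow>\<^sub>E carrier Y) (gen_shift \<Gamma> \<psi>)"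

definition shift_set :: "('y, 'b) monoid_scheme \<Rightarrow> 'i set \<Rightarrow> ('i \<Rightarrow> 'i) \<Rightarrow> ereal" where
  "shift_set Y \<Gamma> \<psi> = ent_set (\<Gamma> \<rightarrow>\<^sub>E carrier Y) (gen_shift \<Gamma> \<psi>)"

end

theory Submission
  imports Defs
begin

text \<open>
  The inequalities hold for a coarse reason: in each of them the smaller side is \<open>0\<close> or the larger
  side is \<open>\<infinity>\<close>, and the dynamics of the index map \<open>\<psi>\<close> decides which. Write \<open>\<sigma>\<close> for the shift and
  \<open>t\<close>, \<open>a\<close>, \<open>c\<close>, \<open>s\<close> for its topological, algebraic, contravariant and set-theoretical entropy.

  If for all \<open>i < j\<close> the maps \<open>\<psi>\<^sup>i\<close> and \<open>\<psi>\<^sup>j\<close> differ at infinitely many indices, a diagonal construction gives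
  infinitely many points with disjoint infinite \<open>\<sigma>\<close>-orbits, so \<open>s = \<infinity>\<close> (\<open>shift_set_eq_infinity\<close>).
  If some pair differs at finitely many indices only, then \<open>\<psi>\<^sup>M = \<psi>\<^sup>M\<^sup>+\<^sup>P\<close> holds globally for some \<open>M\<close> and
  \<open>P > 0\<close> (\<open>funpow_eq_if_disagreement_finite\<close>); the trajectories that define \<open>a\<close> and \<open>c\<close> are then
  bounded, and \<open>a\<close> and \<open>c\<close> vanish. Hence \<open>a \<le> s\<close> and \<open>c \<le> s\<close>.

  If \<open>\<psi>\<close> has an infinite orbit, functions of the height along that orbit give arbitrarily many points of
  the surjective core with disjoint infinite backward orbits, so \<open>c = \<infinity>\<close> (\<open>shift_cset_eq_infinity\<close>).
  If all orbits of \<open>\<psi>\<close> are finite, every open cover is controlled by a finite \<open>\<psi>\<close>-invariant set of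
  indices, so \<open>t = 0\<close> (\<open>shift_top_le_0\<close>). Hence \<open>t \<le> c \<le> s\<close>.

  Three binary shifts over the natural numbers show that no other comparison holds. For the successor map
  \<open>t > 0\<close> while \<open>a = 0\<close>, because backward orbits are finite; then \<open>c\<close> and \<open>s\<close> exceed \<open>a\<close> too. For the
  predecessor map \<open>a > 0\<close> while \<open>t = c = 0\<close>, because every orbit ends at \<open>0\<close>; then \<open>s\<close> exceeds \<open>t\<close> and
  \<open>c\<close>. For disjoint cycles of all lengths \<open>t = 0\<close> but \<open>\<sigma>\<close> is a bijection with a point that is not periodic,
  so \<open>c > 0\<close>.
\<close>

section \<open>Growth rates of forward and backward orbits\<close>

lemma lim_bounded_average:
  fixes f :: "nat \<Rightarrow> real"
  assumes "\<And>n. \<bar>f n\<bar> \<le> K"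
  shows "lim (\<lambda>n. ereal (f n / real n)) = 0"
proof -
  have "(\<lambda>n. f n / real n) \<longlonglongrightarrow> 0"
  proof (rule Lim_null_comparison)
    show "\<forall>\<^sub>F n in sequentially. norm (f n / real n) \<le> K / real n"
      using assms by (auto simp: divide_right_mono)
    show "(\<lambda>n. K / real n) \<longlonglongrightarrow> 0"
      by (rule lim_const_over_n)
  qed
  then have "(\<lambda>n. ereal (f n / real n)) \<longlonglongrightarrow> 0"
    by (simp add: zero_ereal_def)
  then show ?thesis
    by (rule limI)
qed

lemma lim_bounded_card:
  assumes "\<And>n. f n \<le> K"
  shows "lim (\<lambda>n. ereal (real (f n) / real n)) = 0"
  by (rule lim_bounded_average [of _ "real K"]) (simp add: assms)

lemma lim_bounded_ln:
  assumes "\<And>n. f n \<le> K"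
  shows "lim (\<lambda>n. ereal (ln (real (f n)) / real n)) = 0"
proof (rule lim_bounded_average [of _ "ln (real (max 1 K))"])
  fix n
  show "\<bar>ln (real (f n))\<bar> \<le> ln (real (max 1 K))"
    using assms [of n] by (cases "f n = 0") auto
qed

text \<open>Disjoint infinite forward orbits each contribute one new point per step, so the quotient is
  constant for \<open>n > 0\<close>.\<close>

lemma ent_set_ge_card:
  assumes D: "finite D" "D \<subseteq> A"
    and free: "\<And>x y i j. x \<in> D \<Longrightarrow> y \<in> D \<Longrightarrow> (g ^^ i) x = (g ^^ j) y \<Longrightarrow> i = j \<and> x = y"
  shows "ereal (real (card D)) \<le> ent_set A g"
proof -
  have "card (\<Union>i<n. (g ^^ i) ` D) = n * card D" for n
  proof -
    have "card (\<Union>i<n. (g ^^ i) ` D) = (\<Sum>i<n. card ((g ^^ i) ` D))"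
      using D(1) by (intro card_UN_disjoint) (auto dest: free)
    also have "\<dots> = (\<Sum>i<n. card D)"
      using free by (intro sum.cong card_image inj_onI) auto
    finally show ?thesis by simp
  qed
  moreover have "(\<lambda>n. ereal (real (n * card D) / real n)) \<longlonglongrightarrow> ereal (real (card D))"
    by (rule tendsto_eventually, rule eventually_mono [OF eventually_gt_at_top [of 0]]) simp
  ultimately have "ereal (real (card D)) = lim (\<lambda>n. ereal (real (card (\<Union>i<n. (g ^^ i) ` D)) / real n))"
    by (simp only: limI)
  also have "\<dots> \<le> ent_set A g"
    unfolding ent_set_def using D by (intro SUP_upper) auto
  finally show ?thesis .
qed

lemma finite_preimage_funpow:
  assumes "finite_fibre A g" "g \<in> A \<rightarrow> A" "finite D"
  shows "finite {x \<in> A. (g ^^ n) x \<in> D}"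
proof (induction n)
  case 0
  show ?case using assms(3) by (simp add: finite_subset [OF _ assms(3)] subset_eq)
next
  case (Suc n)
  have "{x \<in> A. (g ^^ Suc n) x \<in> D} \<subseteq> (\<Union>y \<in> {y \<in> A. (g ^^ n) y \<in> D}. {x \<in> A. g x = y})"
    using assms(2) by (auto simp: funpow_Suc_right simp del: funpow.simps)
  then show ?case
    by (rule finite_subset) (use Suc assms(1) in \<open>auto simp: finite_fibre_def\<close>)
qed

lemma funpow_in: "g \<in> A \<rightarrow> A \<Longrightarrow> x \<in> A \<Longrightarrow> (g ^^ n) x \<in> A"
  by (induction n) auto

text \<open>In the backward count the number \<open>b n\<close> of new points is nondecreasing. Then the averages increase
  as well, starting from the value \<open>0\<close> that division by zero gives at \<open>n = 0\<close>, so their limit exists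
  as a supremum.\<close>

lemma incseq_average:
  fixes b :: "nat \<Rightarrow> nat"
  assumes "mono b"
  shows "incseq (\<lambda>n. ereal (real (\<Sum>i<n. b i) / real n))"
proof (rule incseq_SucI)
  fix n
  have "(\<Sum>i<n. b i) \<le> (\<Sum>i<n. b n)"
    using assms by (intro sum_mono) (auto simp: mono_def)
  then have "real (\<Sum>i<n. b i) \<le> real n * real (b n)"
    unfolding of_nat_mult [symmetric] of_nat_le_iff by simp
  then show "ereal (real (\<Sum>i<n. b i) / real n) \<le> ereal (real (\<Sum>i<Suc n. b i) / real (Suc n))"
    by (cases "n = 0") (auto simp: field_simps)
qed

text \<open>The level sets \<open>B i = g\<^sup>-\<^sup>i D\<close> are pairwise disjoint because no point of \<open>D\<close> is an iterate of another
  one or of itself, and their sizes do not decrease because \<open>g\<close> is onto.\<close>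

lemma ent_cset_onto_ge_card:
  assumes ff: "finite_fibre A g" and onto: "g ` A = A"
    and D: "finite D" "D \<subseteq> A"
    and free: "\<And>x y p. x \<in> D \<Longrightarrow> y \<in> D \<Longrightarrow> (g ^^ p) x = y \<Longrightarrow> p = 0"
  shows "ereal (real (card D)) \<le> ent_cset_onto A g"
proof -
  define B where "B i = {x \<in> A. (g ^^ i) x \<in> D}" for i
  have gA: "g \<in> A \<rightarrow> A" using onto by auto
  have fin: "finite (B i)" for i
    unfolding B_def by (rule finite_preimage_funpow [OF ff gA D(1)])
  have disj: "B i \<inter> B j = {}" if "i < j" for i j
  proof -
    have False if x: "(g ^^ i) x \<in> D" "(g ^^ j) x \<in> D" for x
    proof -
      have "(g ^^ (j - i)) ((g ^^ i) x) = (g ^^ j) x"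
        using \<open>i < j\<close> by (simp flip: funpow_add o_apply [of "g ^^ (j - i)" "g ^^ i"])
      from free [OF x this] \<open>i < j\<close> show False by simp
    qed
    then show ?thesis by (auto simp: B_def)
  qed
  have "B i \<subseteq> g ` B (Suc i)" for i
  proof
    fix y assume y: "y \<in> B i"
    then obtain x where "x \<in> A" "y = g x" using onto by (auto simp: B_def)
    with y show "y \<in> g ` B (Suc i)"
      by (auto simp: B_def funpow_Suc_right simp del: funpow.simps)
  qed
  then have mono: "mono (\<lambda>i. card (B i))"
    by (auto intro!: incseq_SucI surj_card_le fin)
  have "card (\<Union>i<n. B i) = (\<Sum>i<n. card (B i))" for n
    using fin disj by (intro card_UN_disjoint) (auto, metis disjoint_iff linorder_neqE_nat)
  then have lim: "lim (\<lambda>n. ereal (real (card (\<Union>i<n. B i)) / real n))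
      = (SUP n. ereal (real (\<Sum>i<n. card (B i)) / real n))"
    using LIMSEQ_SUP [OF incseq_average [OF mono]] by (simp add: limI)
  have "B 0 = D" using D(2) by (auto simp: B_def)
  then have "ereal (real (card D)) = ereal (real (\<Sum>i<1. card (B i)) / real (1::nat))"
    by simp
  also have "\<dots> \<le> lim (\<lambda>n. ereal (real (card (\<Union>i<n. B i)) / real n))"
    unfolding lim by (rule SUP_upper) simp
  also have "\<dots> \<le> ent_cset_onto A g"
    unfolding ent_cset_onto_def B_def using D by (intro SUP_upper) auto
  finally show ?thesis .
qed

lemma ent_cset_nonneg: "0 \<le> ent_cset A g"
proof -
  have "0 = lim (\<lambda>n. ereal (real (card (\<Union>i<n. {x \<in> surjective_core A g. (g ^^ i) x \<in> {}})) / real n))"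
    by (rule lim_bounded_card [symmetric, of _ 0]) simp
  also have "\<dots> \<le> ent_cset A g"
    unfolding ent_cset_def ent_cset_onto_def by (rule SUP_upper) auto
  finally show ?thesis .
qed

lemma ent_cset_le_0:
  assumes "\<And>D. finite D \<Longrightarrow> finite (\<Union>i. {x \<in> surjective_core A g. (g ^^ i) x \<in> D})"
  shows "ent_cset A g \<le> 0"
  unfolding ent_cset_def ent_cset_onto_def
proof (rule SUP_least)
  fix D assume "D \<in> {D. finite D \<and> D \<subseteq> surjective_core A g}"
  then have "finite (\<Union>i. {x \<in> surjective_core A g. (g ^^ i) x \<in> D})" (is "finite ?U")
    using assms by blast
  then have bound: "card (\<Union>i<n. {x \<in> surjective_core A g. (g ^^ i) x \<in> D}) \<le> card ?U" for n
    by (rule card_mono) auto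
  then show "lim (\<lambda>n. ereal (real (card (\<Union>i<n. {x \<in> surjective_core A g. (g ^^ i) x \<in> D})) / real n)) \<le> 0"
    by (intro eq_refl lim_bounded_card [OF bound])
qed

lemma surjective_core_subset:
  assumes "g \<in> A \<rightarrow> A"
  shows "surjective_core A g \<subseteq> A"
proof -
  have "surjective_core A g \<subseteq> (g ^^ 1) ` A"
    unfolding surjective_core_def by (rule INT_lower) simp
  also have "\<dots> \<subseteq> A" using assms by auto
  finally show ?thesis .
qed

text \<open>For finite fibres this is a compactness argument: the sets \<open>g\<^sup>n A \<inter> g\<^sup>-\<^sup>1 y\<close> are finite, nonempty and
  decreasing, hence have a common point.\<close>

lemma image_surjective_core:
  assumes ff: "finite_fibre A g" and gA: "g \<in> A \<rightarrow> A"
  shows "g ` surjective_core A g = surjective_core A g"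
proof
  have Suc_sub: "(g ^^ Suc n) ` A \<subseteq> (g ^^ n) ` A" for n
    using gA by (auto simp: funpow_Suc_right simp del: funpow.simps)
  have desc: "(g ^^ n) ` A \<subseteq> (g ^^ m) ` A" if "m \<le> n" for m n
    using Suc_sub that by (rule lift_Suc_antimono_le [of "\<lambda>n. (g ^^ n) ` A"])
  show "g ` surjective_core A g \<subseteq> surjective_core A g"
  proof (clarsimp simp: surjective_core_def)
    fix x n assume "\<forall>n\<in>{Suc 0..}. x \<in> (g ^^ n) ` A" and "Suc 0 \<le> n"
    then obtain z where "z \<in> A" "x = (g ^^ n) z" by auto
    then have "g x \<in> (g ^^ Suc n) ` A" by auto
    then show "g x \<in> (g ^^ n) ` A" using Suc_sub by blast
  qed
  show "surjective_core A g \<subseteq> g ` surjective_core A g"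
  proof
    fix y assume y: "y \<in> surjective_core A g"
    define F where "F n = {x \<in> (g ^^ n) ` A. g x = y}" for n
    have F0: "finite (F 0)"
      using ff by (simp add: F_def finite_fibre_def)
    have sub: "F n \<subseteq> F m" if "m \<le> n" for m n
      using desc [OF that] by (auto simp: F_def)
    have ne: "F n \<noteq> {}" for n
    proof -
      have "y \<in> (g ^^ Suc n) ` A" using INT_D [OF y [unfolded surjective_core_def], of "Suc n"] by simp
      then show ?thesis by (auto simp: F_def)
    qed
    have "\<exists>x\<in>F 0. \<forall>n. x \<in> F n"
    proof (rule ccontr)
      assume "\<not> ?thesis"
      then obtain N where N: "\<And>x. x \<in> F 0 \<Longrightarrow> x \<notin> F (N x)" by metis
      obtain x where x: "x \<in> F (Max (N ` F 0))" using ne by blast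
      then have "x \<in> F 0" using sub by blast
      moreover have "x \<in> F (N x)"
        using x sub [of "N x" "Max (N ` F 0)"] F0 \<open>x \<in> F 0\<close> by auto
      ultimately show False using N by blast
    qed
    then show "y \<in> g ` surjective_core A g"
      by (auto simp: F_def surjective_core_def)
  qed
qed

lemma finite_fibre_subset:
  assumes "finite_fibre A g" "B \<subseteq> A"
  shows "finite_fibre B g"
  unfolding finite_fibre_def
proof
  fix y
  have "{x \<in> B. g x = y} \<subseteq> {x \<in> A. g x = y}" using assms(2) by blast
  moreover have "finite {x \<in> A. g x = y}" using assms(1) by (simp add: finite_fibre_def)
  ultimately show "finite {x \<in> B. g x = y}" by (rule finite_subset)
qed

lemma ereal_infinity_if_ge_nat:
  assumes "\<And>N :: nat. ereal (real N) \<le> x"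
  shows "x = \<infinity>"
proof (cases x)
  case (real r)
  obtain N :: nat where "r < real N" using reals_Archimedean2 by blast
  with assms [of N] real show ?thesis by simp
qed (use assms [of 0] in auto)

section \<open>Iterates of generalized shifts\<close>

lemma gen_shift_in: "\<psi> \<in> \<Gamma> \<rightarrow> \<Gamma> \<Longrightarrow> gen_shift \<Gamma> \<psi> \<in> (\<Gamma> \<rightarrow>\<^sub>E S) \<rightarrow> (\<Gamma> \<rightarrow>\<^sub>E S)"
  by (auto simp: gen_shift_def)

lemma gen_shift_funpow:
  assumes \<psi>: "\<psi> \<in> \<Gamma> \<rightarrow> \<Gamma>" and x: "x \<in> \<Gamma> \<rightarrow>\<^sub>E S"
  shows "(gen_shift \<Gamma> \<psi> ^^ n) x = (\<lambda>\<alpha>\<in>\<Gamma>. x ((\<psi> ^^ n) \<alpha>))"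
proof (induction n)
  case 0
  show ?case using x by (auto simp: PiE_def extensional_restrict)
next
  case (Suc n)
  then show ?case
    using \<psi> by (auto simp: gen_shift_def fun_eq_iff restrict_def funpow_swap1)
qed

lemma gen_shift_funpow_in:
  assumes "\<psi> \<in> \<Gamma> \<rightarrow> \<Gamma>" "x \<in> \<Gamma> \<rightarrow>\<^sub>E S"
  shows "(gen_shift \<Gamma> \<psi> ^^ n) x \<in> \<Gamma> \<rightarrow>\<^sub>E S"
  using funpow_in [OF gen_shift_in [OF assms(1)] assms(2)] .

section \<open>Set-theoretical entropy of a shift and periodicity of the index map\<close>

text \<open>Eventual periodicity survives enlarging the preperiod and multiplying the period; this merges
  finitely many eventually periodic points into one global identity.\<close>

lemma eventually_periodic_stable:
  fixes \<psi> :: "'a \<Rightarrow> 'a"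
  assumes per: "(\<psi> ^^ i) \<alpha> = (\<psi> ^^ (i + d)) \<alpha>"
    and "i \<le> M" "d dvd P"
  shows "(\<psi> ^^ M) \<alpha> = (\<psi> ^^ (M + P)) \<alpha>"
proof -
  have step: "(\<psi> ^^ (m + d)) \<alpha> = (\<psi> ^^ m) \<alpha>" if "i \<le> m" for m
  proof -
    have "(\<psi> ^^ (m + d)) \<alpha> = (\<psi> ^^ (m - i)) ((\<psi> ^^ (i + d)) \<alpha>)"
      using that by (simp flip: funpow_add o_apply [of "\<psi> ^^ (m - i)" "\<psi> ^^ (i + d)"])
    also have "\<dots> = (\<psi> ^^ m) \<alpha>"
      using that unfolding per [symmetric]
      by (simp flip: funpow_add o_apply [of "\<psi> ^^ (m - i)" "\<psi> ^^ i"])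
    finally show ?thesis .
  qed
  have "(\<psi> ^^ (M + d * k)) \<alpha> = (\<psi> ^^ M) \<alpha>" for k
    using step [of "M + d * _"] \<open>i \<le> M\<close> by (induction k) (simp_all add: algebra_simps)
  with \<open>d dvd P\<close> show ?thesis by (auto elim!: dvdE)
qed

text \<open>A point whose orbit leaves the finite set of disagreement is eventually periodic because
  \<open>\<psi>\<^sup>i\<close> and \<open>\<psi>\<^sup>j\<close> agree there; a point whose orbit stays in it is eventually periodic by the pigeonhole
  principle. Only finitely many preperiods and periods have to be combined.\<close>

lemma funpow_eq_if_disagreement_finite:
  assumes "i < j" and fin: "finite {\<alpha> \<in> \<Gamma>. (\<psi> ^^ i) \<alpha> \<noteq> (\<psi> ^^ j) \<alpha>}" (is "finite ?E")
    and \<psi>: "\<psi> \<in> \<Gamma> \<rightarrow> \<Gamma>"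
  shows "\<exists>M P. P > 0 \<and> (\<forall>\<alpha>\<in>\<Gamma>. (\<psi> ^^ M) \<alpha> = (\<psi> ^^ (M + P)) \<alpha>)"
proof -
  have "\<exists>m d. d > 0 \<and> (\<psi> ^^ m) \<alpha> = (\<psi> ^^ (m + d)) \<alpha>" if \<alpha>: "\<alpha> \<in> \<Gamma>" for \<alpha>
  proof (cases "\<forall>n. (\<psi> ^^ n) \<alpha> \<in> ?E")
    case True
    then have "finite (range (\<lambda>n. (\<psi> ^^ n) \<alpha>))"
      using fin by (blast intro: finite_subset)
    then have "\<not> inj (\<lambda>n. (\<psi> ^^ n) \<alpha>)"
      using finite_imageD infinite_UNIV_nat by blast
    then obtain p q where "p < q" "(\<psi> ^^ p) \<alpha> = (\<psi> ^^ q) \<alpha>"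
      unfolding inj_on_def by (metis linorder_neqE_nat)
    then show ?thesis
      by (auto intro!: exI [of _ p, OF exI [of _ "q - p"]])
  next
    case False
    then obtain n where "(\<psi> ^^ n) \<alpha> \<notin> ?E" by blast
    then have "(\<psi> ^^ i) ((\<psi> ^^ n) \<alpha>) = (\<psi> ^^ j) ((\<psi> ^^ n) \<alpha>)"
      using funpow_in [OF \<psi> \<alpha>] by auto
    then have "(\<psi> ^^ (i + n)) \<alpha> = (\<psi> ^^ (j + n)) \<alpha>"
      by (simp add: funpow_add)
    with \<open>i < j\<close> show ?thesis
      by (auto intro!: exI [of _ "i + n", OF exI [of _ "j - i"]] simp: add.commute)
  qed
  then obtain m d where md: "\<And>\<alpha>. \<alpha> \<in> \<Gamma> \<Longrightarrow> d \<alpha> > 0"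
      "\<And>\<alpha>. \<alpha> \<in> \<Gamma> \<Longrightarrow> (\<psi> ^^ m \<alpha>) \<alpha> = (\<psi> ^^ (m \<alpha> + d \<alpha>)) \<alpha>"
    by metis
  define M where "M = i + sum m ?E"
  define P where "P = (j - i) * prod d ?E"
  have "P > 0"
    using md(1) \<open>i < j\<close> by (auto simp: P_def intro!: prod_pos)
  moreover have "(\<psi> ^^ M) \<alpha> = (\<psi> ^^ (M + P)) \<alpha>" if \<alpha>: "\<alpha> \<in> \<Gamma>" for \<alpha>
  proof (cases "\<alpha> \<in> ?E")
    case True
    have "m \<alpha> \<le> sum m ?E"
      by (rule member_le_sum [OF True _ fin]) simp
    moreover have "d \<alpha> dvd prod d ?E"
      by (rule dvd_prodI [OF fin True])
    ultimately show ?thesis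
      by (intro eventually_periodic_stable [OF md(2) [OF \<alpha>]]) (simp_all add: M_def P_def)
  next
    case False
    with \<alpha> \<open>i < j\<close> have "(\<psi> ^^ i) \<alpha> = (\<psi> ^^ (i + (j - i))) \<alpha>" by simp
    then show ?thesis
      by (rule eventually_periodic_stable) (simp_all add: M_def P_def)
  qed
  ultimately show ?thesis by blast
qed

text \<open>A greedy choice: the finitely many values taken before \<open>r\<close> exclude only finitely many elements of
  the infinite set \<open>E r\<close>.\<close>

lemma choose_disjoint_pairs:
  fixes E :: "nat \<Rightarrow> 'a set" and u v :: "nat \<Rightarrow> 'a \<Rightarrow> 'b"
  assumes inf: "\<And>r. infinite (E r)"
    and fib: "\<And>r F. finite F \<Longrightarrow> finite {\<alpha> \<in> E r. u r \<alpha> \<in> F}"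
             "\<And>r F. finite F \<Longrightarrow> finite {\<alpha> \<in> E r. v r \<alpha> \<in> F}"
  shows "\<exists>f. (\<forall>r. f r \<in> E r) \<and>
    (\<forall>r s. r \<noteq> s \<longrightarrow> {u r (f r), v r (f r)} \<inter> {u s (f s), v s (f s)} = {})"
proof -
  define P where "P f r a \<longleftrightarrow> a \<in> E r \<and>
      (\<forall>s<r. {u r a, v r a} \<inter> {u s (f s), v s (f s)} = {})" for f r a
  have "\<exists>f. \<forall>r. P f r (f r)"
  proof (rule dependent_wellorder_choice)
    fix r and f :: "nat \<Rightarrow> 'a"
    define F where "F = (\<Union>s<r. {u s (f s), v s (f s)})"
    have "finite F" by (simp add: F_def)
    then have "finite ({\<alpha> \<in> E r. u r \<alpha> \<in> F} \<union> {\<alpha> \<in> E r. v r \<alpha> \<in> F})"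
      using fib by blast
    then obtain a where "a \<in> E r - ({\<alpha> \<in> E r. u r \<alpha> \<in> F} \<union> {\<alpha> \<in> E r. v r \<alpha> \<in> F})"
      by (metis Diff_infinite_finite [OF _ inf] ex_in_conv finite.emptyI)
    then have "P f r a" by (auto simp: P_def F_def)
    then show "\<exists>a. P f r a" ..
  qed (simp add: P_def)
  then obtain f where f: "\<And>r. P f r (f r)" by blast
  have "{u r (f r), v r (f r)} \<inter> {u s (f s), v s (f s)} = {}" if "r \<noteq> s" for r s
    using f [of r] f [of s] that unfolding P_def by (metis Int_commute linorder_neqE_nat)
  with f show ?thesis unfolding P_def by blast
qed

text \<open>A diagonal construction of points \<open>x 0, x 1, ...\<close> with disjoint infinite orbits. There are countably
  many requirements \<open>\<sigma>\<^sup>i (x k) \<noteq> \<sigma>\<^sup>j (x l)\<close>. The requirement with number \<open>r\<close> is met at a coordinate \<open>f r\<close>,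
  by giving \<open>x k\<close> the value \<open>a\<close> at \<open>\<psi>\<^sup>i (f r)\<close> and keeping \<open>x l\<close> trivial at \<open>\<psi>\<^sup>j (f r)\<close>. The infinitely many
  coordinates of disagreement leave room to choose these places disjoint for different \<open>r\<close>.\<close>

lemma shift_set_eq_infinity:
  assumes cl: "shift_class Y \<Gamma> \<psi>"
    and inf: "\<And>i j. i < j \<Longrightarrow> infinite {\<alpha> \<in> \<Gamma>. (\<psi> ^^ i) \<alpha> \<noteq> (\<psi> ^^ j) \<alpha>}"
  shows "shift_set Y \<Gamma> \<psi> = \<infinity>"
proof -
  interpret group Y using cl by (simp add: shift_class_def)
  have \<psi>: "\<psi> \<in> \<Gamma> \<rightarrow> \<Gamma>" and ff: "finite_fibre \<Gamma> \<psi>"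
    using cl by (auto simp: shift_class_def)
  obtain a where a: "a \<in> carrier Y" "a \<noteq> \<one>\<^bsub>Y\<^esub>"
    using cl one_closed by (auto simp: shift_class_def)
  define C :: "(nat \<times> nat \<times> nat \<times> nat) set" where "C = {(i, k, j, l). (i, k) \<noteq> (j, l)}"
  have "C \<noteq> {}" by (auto simp: C_def)
  then have "range (from_nat_into C) = C"
    by (intro range_from_nat_into countableI_type)
  then obtain c :: "nat \<Rightarrow> nat \<times> nat \<times> nat \<times> nat" where c: "range c = C" by blast
  define I where "I r = fst (c r)" for r
  define K where "K r = fst (snd (c r))" for r
  define J where "J r = fst (snd (snd (c r)))" for r
  define L where "L r = snd (snd (snd (c r)))" for r
  have c_eq: "c r = (I r, K r, J r, L r)" for r
    by (simp add: I_def K_def J_def L_def)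
  have ne: "(I r, K r) \<noteq> (J r, L r)" for r
  proof -
    have "c r \<in> C" using c by blast
    then show ?thesis by (auto simp: c_eq C_def)
  qed
  \<comment> \<open>For \<open>i = j\<close> the requirement has \<open>k \<noteq> l\<close> and can be met at any coordinate.\<close>
  define E where "E r = {\<alpha> \<in> \<Gamma>. I r \<noteq> J r \<longrightarrow> (\<psi> ^^ I r) \<alpha> \<noteq> (\<psi> ^^ J r) \<alpha>}" for r
  have infE: "infinite (E r)" for r
  proof (cases "I r = J r")
    case True
    then have "{\<alpha> \<in> \<Gamma>. (\<psi> ^^ 0) \<alpha> \<noteq> (\<psi> ^^ 1) \<alpha>} \<subseteq> E r" by (auto simp: E_def)
    then show ?thesis using inf [of 0 1] by (meson finite_subset zero_less_one)
  next
    case False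
    then have "E r = {\<alpha> \<in> \<Gamma>. (\<psi> ^^ I r) \<alpha> \<noteq> (\<psi> ^^ J r) \<alpha>}"
        "E r = {\<alpha> \<in> \<Gamma>. (\<psi> ^^ J r) \<alpha> \<noteq> (\<psi> ^^ I r) \<alpha>}"
      by (auto simp: E_def)
    with False inf show ?thesis by (metis linorder_neqE_nat)
  qed
  have finE: "finite {\<alpha> \<in> E r. (\<psi> ^^ n) \<alpha> \<in> F}" if "finite F" for r n F
    by (rule finite_subset [OF _ finite_preimage_funpow [OF ff \<psi> that]]) (auto simp: E_def)
  obtain f where f: "\<And>r. f r \<in> E r" and
      disj: "\<And>r s. r \<noteq> s \<Longrightarrow> {(\<psi> ^^ I r) (f r), (\<psi> ^^ J r) (f r)} \<inter> {(\<psi> ^^ I s) (f s), (\<psi> ^^ J s) (f s)} = {}"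
    using choose_disjoint_pairs [of E "\<lambda>r. \<psi> ^^ I r" "\<lambda>r. \<psi> ^^ J r", OF infE finE finE] by metis
  \<comment> \<open>The value \<open>a\<close> only where some requirement demands it: this is what keeps the other side trivial.\<close>
  define x where "x k = (\<lambda>\<beta>\<in>\<Gamma>. if \<exists>r. K r = k \<and> \<beta> = (\<psi> ^^ I r) (f r) then a else \<one>\<^bsub>Y\<^esub>)" for k
  have x_in: "x k \<in> \<Gamma> \<rightarrow>\<^sub>E carrier Y" for k
    using a by (auto simp: x_def)
  have free: "i = j \<and> k = l"
    if eq: "(gen_shift \<Gamma> \<psi> ^^ i) (x k) = (gen_shift \<Gamma> \<psi> ^^ j) (x l)" for i j k l
  proof (rule ccontr)
    assume "\<not> (i = j \<and> k = l)"
    then have "(i, k, j, l) \<in> C" by (auto simp: C_def)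
    then have "(i, k, j, l) \<in> range c" by (simp add: c)
    then obtain r where "c r = (i, k, j, l)" by (elim imageE) simp
    then have r: "I r = i" "K r = k" "J r = j" "L r = l"
      by (simp_all add: I_def K_def J_def L_def)
    have fr: "f r \<in> \<Gamma>" using f [of r] by (simp add: E_def)
    have "x k ((\<psi> ^^ i) (f r)) = x l ((\<psi> ^^ j) (f r))"
      using fun_cong [OF eq, of "f r"] fr by (simp add: gen_shift_funpow [OF \<psi> x_in])
    moreover have "x k ((\<psi> ^^ i) (f r)) = a"
      using r funpow_in [OF \<psi> fr] by (auto simp: x_def)
    ultimately have "x l ((\<psi> ^^ j) (f r)) \<noteq> \<one>\<^bsub>Y\<^esub>" using a by simp
    then obtain s where s: "K s = l" "(\<psi> ^^ j) (f r) = (\<psi> ^^ I s) (f s)"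
      using funpow_in [OF \<psi> fr] by (auto simp: x_def split: if_splits)
    then have "s = r" using disj [of r s] r by auto
    then have "k = l" "(\<psi> ^^ j) (f r) = (\<psi> ^^ i) (f r)" using r s by auto
    moreover have "i \<noteq> j" using ne [of r] r \<open>k = l\<close> by simp
    ultimately show False using f [of r] r by (simp add: E_def)
  qed
  have "ereal (real N) \<le> shift_set Y \<Gamma> \<psi>" for N
  proof -
    have "inj_on x {..<N}"
      using free [of 0 _ 0] by (auto intro!: inj_onI)
    then have "card (x ` {..<N}) = N" by (simp add: card_image)
    moreover have "ereal (real (card (x ` {..<N}))) \<le> ent_set (\<Gamma> \<rightarrow>\<^sub>E carrier Y) (gen_shift \<Gamma> \<psi>)"
      using x_in by (intro ent_set_ge_card) (auto dest: free)
    ultimately show ?thesis by (simp add: shift_set_def)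
  qed
  then show ?thesis by (rule ereal_infinity_if_ge_nat)
qed

section \<open>Contravariant entropy of a shift with an infinite orbit\<close>

lemma shift_cset_ge_card:
  assumes cl: "shift_class Y \<Gamma> \<psi>"
    and D: "finite D" "D \<subseteq> surjective_core (\<Gamma> \<rightarrow>\<^sub>E carrier Y) (gen_shift \<Gamma> \<psi>)"
    and free: "\<And>x y p. x \<in> D \<Longrightarrow> y \<in> D \<Longrightarrow> (gen_shift \<Gamma> \<psi> ^^ p) x = y \<Longrightarrow> p = 0"
  shows "ereal (real (card D)) \<le> shift_cset Y \<Gamma> \<psi>"
proof -
  have "\<psi> \<in> \<Gamma> \<rightarrow> \<Gamma>" and ff: "finite_fibre (\<Gamma> \<rightarrow>\<^sub>E carrier Y) (gen_shift \<Gamma> \<psi>)"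
    using cl by (simp_all add: shift_class_def)
  then have in_A: "gen_shift \<Gamma> \<psi> \<in> (\<Gamma> \<rightarrow>\<^sub>E carrier Y) \<rightarrow> (\<Gamma> \<rightarrow>\<^sub>E carrier Y)"
    by (intro gen_shift_in)
  let ?C = "surjective_core (\<Gamma> \<rightarrow>\<^sub>E carrier Y) (gen_shift \<Gamma> \<psi>)"
  have "finite_fibre ?C (gen_shift \<Gamma> \<psi>)"
    using ff surjective_core_subset [OF in_A] by (rule finite_fibre_subset)
  then show ?thesis
    unfolding shift_cset_def ent_cset_def
    using image_surjective_core [OF ff in_A] D free by (intro ent_cset_onto_ge_card)
qed

text \<open>Along an infinite orbit \<open>\<alpha>, \<psi> \<alpha>, \<psi>\<^sup>2 \<alpha>, ...\<close> there is a height: \<open>h \<beta> = n - m\<close> when \<open>\<psi>\<^sup>m \<beta> = \<psi>\<^sup>n \<alpha>\<close>. It grows by one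
  under \<open>\<psi>\<close>, so \<open>lift f = f \<circ> h\<close>, extended trivially off the orbits that meet that of \<open>\<alpha>\<close>, carries the
  bilateral shift of functions on the integers into \<open>\<sigma>\<close>. As the bilateral shift is invertible, every
  \<open>lift f\<close> lies in the surjective core. It remains to find arbitrarily many \<open>f\<close> whose lifts are no
  iterates of one another.\<close>

lemma shift_cset_eq_infinity:
  assumes cl: "shift_class Y \<Gamma> \<psi>" and \<alpha>: "\<alpha> \<in> \<Gamma>" and inj: "inj (\<lambda>n. (\<psi> ^^ n) \<alpha>)"
  shows "shift_cset Y \<Gamma> \<psi> = \<infinity>"
proof -
  interpret group Y using cl by (simp add: shift_class_def)
  have \<psi>: "\<psi> \<in> \<Gamma> \<rightarrow> \<Gamma>"
    using cl by (auto simp: shift_class_def)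
  obtain a where a: "a \<in> carrier Y" "a \<noteq> \<one>\<^bsub>Y\<^esub>"
    using cl one_closed by (auto simp: shift_class_def)
  let ?\<sigma> = "gen_shift \<Gamma> \<psi>" and ?A = "\<Gamma> \<rightarrow>\<^sub>E carrier Y"
  define meets where "meets m n \<beta> \<longleftrightarrow> (\<psi> ^^ m) \<beta> = (\<psi> ^^ n) \<alpha>" for m n \<beta>
  define h where "h \<beta> = (THE z. \<exists>m n. meets m n \<beta> \<and> z = int n - int m)" for \<beta>
  have h: "h \<beta> = int n - int m" if mn: "meets m n \<beta>" for m n \<beta>
    unfolding h_def
  proof (rule the_equality)
    fix z assume "\<exists>m n. meets m n \<beta> \<and> z = int n - int m"
    then obtain m' n' where mn': "meets m' n' \<beta>" "z = int n' - int m'" by blast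
    have "(\<psi> ^^ (m' + n)) \<alpha> = (\<psi> ^^ (m' + m)) \<beta>"
      using mn by (simp add: meets_def funpow_add)
    also have "\<dots> = (\<psi> ^^ (m + n')) \<alpha>"
      using mn' by (simp add: meets_def funpow_add add.commute [of m' m])
    finally have "m' + n = m + n'" using injD [OF inj] by blast
    then show "z = int n - int m" using mn' by simp
  qed (use mn in blast)
  have meets_\<alpha>: "meets 0 n ((\<psi> ^^ n) \<alpha>)" for n by (simp add: meets_def)
  have meets_shift: "meets m (p + n) ((\<psi> ^^ p) \<beta>)" if "meets m n \<beta>" for m n p \<beta>
  proof -
    have "(\<psi> ^^ m) ((\<psi> ^^ p) \<beta>) = (\<psi> ^^ p) ((\<psi> ^^ m) \<beta>)"
      by (simp flip: funpow_add o_apply [of "\<psi> ^^ m" "\<psi> ^^ p"] o_apply [of "\<psi> ^^ p" "\<psi> ^^ m"] add: add.commute)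
    with that show ?thesis by (simp add: meets_def funpow_add)
  qed
  have meets_unshift: "meets (m + p) n \<beta>" if "meets m n ((\<psi> ^^ p) \<beta>)" for m n p \<beta>
    using that by (simp add: meets_def funpow_add)
  define lift where "lift f = (\<lambda>\<beta>\<in>\<Gamma>. if \<exists>m n. meets m n \<beta> then f (h \<beta>) else \<one>\<^bsub>Y\<^esub>)" for f
  have lift_in: "lift f \<in> ?A" if "range f \<subseteq> carrier Y" for f
    using that by (auto simp: lift_def image_subset_iff)
  have lift_\<alpha>: "lift f ((\<psi> ^^ n) \<alpha>) = f (int n)" for f n
    using meets_\<alpha> [of n] h [OF meets_\<alpha>] funpow_in [OF \<psi> \<alpha>] by (auto simp: lift_def)
  have shift_lift: "(?\<sigma> ^^ p) (lift f) = lift (\<lambda>z. f (z + int p))" if f: "range f \<subseteq> carrier Y" for f p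
  proof -
    have "lift f ((\<psi> ^^ p) \<beta>) = lift (\<lambda>z. f (z + int p)) \<beta>" if \<beta>: "\<beta> \<in> \<Gamma>" for \<beta>
    proof (cases "\<exists>m n. meets m n \<beta>")
      case True
      then obtain m n where mn: "meets m n \<beta>" by blast
      have "h ((\<psi> ^^ p) \<beta>) = h \<beta> + int p"
        using h [OF mn] h [OF meets_shift [OF mn]] by simp
      then show ?thesis
        using mn meets_shift [OF mn] \<beta> funpow_in [OF \<psi> \<beta>] by (auto simp: lift_def)
    next
      case False
      then have "\<not> (\<exists>m n. meets m n ((\<psi> ^^ p) \<beta>))" using meets_unshift by blast
      with False show ?thesis
        using \<beta> funpow_in [OF \<psi> \<beta>] by (simp add: lift_def)
    qed
    then show ?thesis
      unfolding gen_shift_funpow [OF \<psi> lift_in [OF f]]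
      by (auto simp: lift_def restrict_def)
  qed
  have core: "lift f \<in> surjective_core ?A ?\<sigma>" if f: "range f \<subseteq> carrier Y" for f
    unfolding surjective_core_def
  proof
    fix n
    have "lift f = (?\<sigma> ^^ n) (lift (\<lambda>z. f (z - int n)))"
      using f by (subst shift_lift) auto
    moreover have "lift (\<lambda>z. f (z - int n)) \<in> ?A" using f by (intro lift_in) auto
    ultimately show "lift f \<in> (?\<sigma> ^^ n) ` ?A" by blast
  qed
  \<comment> \<open>Shifting the two-point support \<open>{0, k + 1}\<close> by \<open>p > 0\<close> leaves at most one point that is \<open>\<ge> 0\<close>,
    and only values at heights \<open>\<ge> 0\<close> can be compared, since \<open>h\<close> need not be negative anywhere.\<close>
  define f where "f k z = (if z = 0 \<or> z = int (Suc k) then a else \<one>\<^bsub>Y\<^esub>)" for k z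
  have f: "range (f k) \<subseteq> carrier Y" for k
    using a by (auto simp: f_def)
  have free: "p = 0 \<and> k = l" if eq: "(?\<sigma> ^^ p) (lift (f k)) = lift (f l)" for p k l
  proof -
    have *: "f k (int n + int p) = f l (int n)" for n
      using fun_cong [OF eq, of "(\<psi> ^^ n) \<alpha>"] lift_\<alpha>
      unfolding shift_lift [OF f] by metis
    show ?thesis
      using * [of 0] * [of "Suc l"] a(2) by (auto simp: f_def split: if_splits)
  qed
  have "ereal (real N) \<le> shift_cset Y \<Gamma> \<psi>" for N
  proof -
    have "inj_on (\<lambda>k. lift (f k)) {..<N}"
      using free [of 0] by (auto intro!: inj_onI)
    then have "card ((\<lambda>k. lift (f k)) ` {..<N}) = N" by (simp add: card_image)
    moreover have "ereal (real (card ((\<lambda>k. lift (f k)) ` {..<N}))) \<le> shift_cset Y \<Gamma> \<psi>"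
      using core f by (intro shift_cset_ge_card [OF cl]) (auto dest: free)
    ultimately show ?thesis by simp
  qed
  then show ?thesis by (rule ereal_infinity_if_ge_nat)
qed

section \<open>Vanishing topological entropy\<close>

lemma funpow_reduce:
  fixes g :: "'a \<Rightarrow> 'a"
  assumes "p < q" "(g ^^ p) x = (g ^^ q) x"
  shows "\<exists>j<q. (g ^^ n) x = (g ^^ j) x"
proof (induction n rule: less_induct)
  case (less n)
  show ?case
  proof (cases "n < q")
    case False
    then have "(g ^^ n) x = (g ^^ (n - q)) ((g ^^ q) x)"
      by (metis add.commute comp_apply funpow_add le_add_diff_inverse not_less)
    also have "\<dots> = (g ^^ (n - q + p)) x"
      by (simp add: assms(2) [symmetric] funpow_add)
    finally show ?thesis using less [of "n - q + p"] False assms(1) by simp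
  qed blast
qed

lemma finite_orbit_if_not_inj:
  fixes \<psi> :: "'a \<Rightarrow> 'a"
  assumes "\<not> inj (\<lambda>n. (\<psi> ^^ n) \<alpha>)"
  shows "finite (range (\<lambda>n. (\<psi> ^^ n) \<alpha>))"
proof -
  obtain p q where pq: "p < q" "(\<psi> ^^ p) \<alpha> = (\<psi> ^^ q) \<alpha>"
    using assms unfolding inj_on_def by (metis linorder_neqE_nat)
  have "range (\<lambda>n. (\<psi> ^^ n) \<alpha>) \<subseteq> (\<lambda>n. (\<psi> ^^ n) \<alpha>) ` {..<q}"
    using funpow_reduce [OF pq] by blast
  then show ?thesis by (rule finite_subset) simp
qed

lemma cover_number_le_card:
  assumes "\<V> \<subseteq> \<U>" "finite \<V>" "\<Union>\<V> = topspace X"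
  shows "cover_number X \<U> \<le> card \<V>"
  unfolding cover_number_def using assms by (intro Least_le) blast

lemma iterated_join_subset: "V \<in> iterated_join X T \<U> n \<Longrightarrow> V \<subseteq> topspace X"
  by (cases n) (auto simp: cover_join_def cover_preimage_def)

text \<open>A Lebesgue number lemma for the compact space \<open>S\<^sup>\<Gamma>\<close>: finitely many coordinates
  of a point suffice to name a set of the cover that contains it.\<close>

lemma cover_subordinate_to_cylinders:
  fixes S :: "'y set" and \<Gamma> :: "'i set"
  assumes fin: "finite S" and cov: "finite_open_cover (product_topology (\<lambda>_. discrete_topology S) \<Gamma>) \<U>"
  shows "\<exists>F. finite F \<and> F \<subseteq> \<Gamma> \<and> (\<forall>x \<in> \<Gamma> \<rightarrow>\<^sub>E S. \<exists>U\<in>\<U>. {y \<in> \<Gamma> \<rightarrow>\<^sub>E S. \<forall>\<alpha>\<in>F. y \<alpha> = x \<alpha>} \<subseteq> U)"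
proof -
  let ?X = "product_topology (\<lambda>_. discrete_topology S) \<Gamma>" and ?A = "\<Gamma> \<rightarrow>\<^sub>E S"
  define cyl where "cyl F x = {y \<in> ?A. \<forall>\<alpha>\<in>F. y \<alpha> = x \<alpha>}" for F and x :: "'i \<Rightarrow> 'y"
  have open_cyl: "openin ?X (cyl F x)" if "finite F" "F \<subseteq> \<Gamma>" "x \<in> ?A" for F x
    unfolding openin_product_topology_alt
  proof
    fix y assume y: "y \<in> cyl F x"
    let ?U = "\<lambda>\<alpha>. if \<alpha> \<in> F then {y \<alpha>} else S"
    have "finite {i \<in> \<Gamma>. ?U i \<noteq> topspace (discrete_topology S)}"
      by (rule finite_subset [OF _ \<open>finite F\<close>]) auto
    moreover have "\<forall>i\<in>\<Gamma>. openin (discrete_topology S) (?U i)"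
      using y by (auto simp: cyl_def PiE_iff)
    moreover have "y \<in> Pi\<^sub>E \<Gamma> ?U" using y by (auto simp: cyl_def)
    moreover have "Pi\<^sub>E \<Gamma> ?U \<subseteq> cyl F x"
    proof
      fix z assume z: "z \<in> Pi\<^sub>E \<Gamma> ?U"
      have zU: "z i \<in> ?U i" if "i \<in> \<Gamma>" for i using z that by (rule PiE_mem)
      have "z i \<in> S" if "i \<in> \<Gamma>" for i
        using zU [OF that] PiE_mem [of y \<Gamma> "\<lambda>_. S" i] that y
        by (cases "i \<in> F") (simp_all add: cyl_def)
      moreover have "z i = x i" if "i \<in> F" for i
        using zU [of i] that \<open>F \<subseteq> \<Gamma>\<close> y by (auto simp: cyl_def)
      ultimately show "z \<in> cyl F x"
        using z by (simp add: cyl_def PiE_iff)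
    qed
    ultimately show "\<exists>U. finite {i \<in> \<Gamma>. U i \<noteq> topspace (discrete_topology S)} \<and>
        (\<forall>i\<in>\<Gamma>. openin (discrete_topology S) (U i)) \<and> y \<in> Pi\<^sub>E \<Gamma> U \<and> Pi\<^sub>E \<Gamma> U \<subseteq> cyl F x"
      by (intro exI [of _ ?U] conjI)
  qed
  have "\<exists>F. finite F \<and> F \<subseteq> \<Gamma> \<and> (\<exists>U\<in>\<U>. cyl F x \<subseteq> U)" if x: "x \<in> ?A" for x
  proof -
    have "x \<in> \<Union>\<U>" using cov x by (simp add: finite_open_cover_def)
    then obtain U where U: "U \<in> \<U>" "x \<in> U" by blast
    then have "openin ?X U" using cov by (simp add: finite_open_cover_def)
    then obtain W where W: "finite {i \<in> \<Gamma>. W i \<noteq> S}" "x \<in> Pi\<^sub>E \<Gamma> W" "Pi\<^sub>E \<Gamma> W \<subseteq> U"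
      using U(2) unfolding openin_product_topology_alt by auto
    have "cyl {i \<in> \<Gamma>. W i \<noteq> S} x \<subseteq> Pi\<^sub>E \<Gamma> W"
    proof
      fix y assume y: "y \<in> cyl {i \<in> \<Gamma>. W i \<noteq> S} x"
      have "y i \<in> W i" if "i \<in> \<Gamma>" for i
        using y W(2) that by (cases "W i = S") (auto simp: cyl_def PiE_iff)
      with y show "y \<in> Pi\<^sub>E \<Gamma> W" by (simp add: cyl_def PiE_iff)
    qed
    then have "cyl {i \<in> \<Gamma>. W i \<noteq> S} x \<subseteq> U" using W(3) by (rule subset_trans)
    with W(1) U(1) show ?thesis
      by (intro exI [of _ "{i \<in> \<Gamma>. W i \<noteq> S}"] conjI bexI [of _ U]) auto
  qed
  then obtain F where F: "\<And>x. x \<in> ?A \<Longrightarrow> finite (F x)" "\<And>x. x \<in> ?A \<Longrightarrow> F x \<subseteq> \<Gamma>"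
      "\<And>x. x \<in> ?A \<Longrightarrow> \<exists>U\<in>\<U>. cyl (F x) x \<subseteq> U"
    by metis
  have "compact_space ?X"
    by (simp add: compact_space_product_topology compact_space_discrete_topology fin)
  then have "compactin ?X (topspace ?X)" by (simp only: compact_space_def)
  moreover have "openin ?X W" if "W \<in> (\<lambda>x. cyl (F x) x) ` ?A" for W
    using that open_cyl F by blast
  moreover have "topspace ?X \<subseteq> \<Union>((\<lambda>x. cyl (F x) x) ` ?A)"
    by (auto simp: cyl_def)
  ultimately have "\<exists>\<W>. finite \<W> \<and> \<W> \<subseteq> (\<lambda>x. cyl (F x) x) ` ?A \<and> topspace ?X \<subseteq> \<Union>\<W>"
    by (rule compactinD)
  then obtain \<W> where \<W>: "finite \<W>" "\<W> \<subseteq> (\<lambda>x. cyl (F x) x) ` ?A" "?A \<subseteq> \<Union>\<W>"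
    by auto
  from finite_subset_image [OF \<W>(1,2)]
  obtain P where "P \<subseteq> ?A" "finite P" "\<W> = (\<lambda>x. cyl (F x) x) ` P" by blast
  with \<W>(3) have P: "P \<subseteq> ?A" "finite P" "?A \<subseteq> (\<Union>x\<in>P. cyl (F x) x)" by simp_all
  define G where "G = (\<Union>x\<in>P. F x)"
  have "\<exists>U\<in>\<U>. cyl G y \<subseteq> U" if y: "y \<in> ?A" for y
  proof -
    obtain x where x: "x \<in> P" "y \<in> cyl (F x) x" using P y by blast
    then have "cyl G y \<subseteq> cyl (F x) x" by (auto simp: cyl_def G_def)
    then show ?thesis using F(3) [of x] x P by blast
  qed
  moreover have "finite G"
    unfolding G_def using P(1,2) F(1) by (intro finite_UN_I) auto
  moreover have "G \<subseteq> \<Gamma>"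
    unfolding G_def using P(1) F(2) by (intro UN_least) (rule F(2), rule subsetD)
  ultimately show ?thesis unfolding cyl_def by blast
qed

text \<open>If all forward orbits are finite, the coordinates that control a cover generate a finite invariant
  set \<open>G\<close>. All iterated joins are then refined by the one partition into cylinders over \<open>G\<close>, and their
  covering numbers are bounded.\<close>

lemma shift_top_le_0:
  assumes cl: "shift_class Y \<Gamma> \<psi>"
    and orb: "\<And>\<alpha>. \<alpha> \<in> \<Gamma> \<Longrightarrow> finite (range (\<lambda>n. (\<psi> ^^ n) \<alpha>))"
  shows "shift_top Y \<Gamma> \<psi> \<le> 0"
  unfolding shift_top_def ent_top_def
proof (rule SUP_least)
  have \<psi>: "\<psi> \<in> \<Gamma> \<rightarrow> \<Gamma>" and finY: "finite (carrier Y)"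
    using cl by (auto simp: shift_class_def)
  let ?X = "product_topology (\<lambda>_. discrete_topology (carrier Y)) \<Gamma>"
    and ?A = "\<Gamma> \<rightarrow>\<^sub>E carrier Y" and ?\<sigma> = "gen_shift \<Gamma> \<psi>"
  fix \<U> assume "\<U> \<in> {\<U>. finite_open_cover ?X \<U>}"
  then have "finite_open_cover ?X \<U>" by simp
  from cover_subordinate_to_cylinders [OF finY this]
  obtain F where F: "finite F" "F \<subseteq> \<Gamma>"
      "\<And>x. x \<in> ?A \<Longrightarrow> \<exists>U\<in>\<U>. {y \<in> ?A. \<forall>\<alpha>\<in>F. y \<alpha> = x \<alpha>} \<subseteq> U"
    by (elim exE conjE) simp
  define G where "G = (\<Union>\<alpha>\<in>F. range (\<lambda>n. (\<psi> ^^ n) \<alpha>))"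
  have finG: "finite G" using F orb by (auto simp: G_def)
  define cyl where "cyl x = {y \<in> ?A. \<forall>\<alpha>\<in>G. y \<alpha> = x \<alpha>}" for x
  have sub: "\<exists>V\<in>iterated_join ?X ?\<sigma> \<U> n. cyl x \<subseteq> V" if x: "x \<in> ?A" for x n
  proof (induction n)
    case 0
    show ?case by (auto simp: cyl_def)
  next
    case (Suc n)
    then obtain V where V: "V \<in> iterated_join ?X ?\<sigma> \<U> n" "cyl x \<subseteq> V" by blast
    obtain U where U: "U \<in> \<U>" "{y \<in> ?A. \<forall>\<alpha>\<in>F. y \<alpha> = (?\<sigma> ^^ n) x \<alpha>} \<subseteq> U"
      using F(3) [OF gen_shift_funpow_in [OF \<psi> x]] by blast
    have "(?\<sigma> ^^ n) y \<in> U" if y: "y \<in> cyl x" for y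
    proof -
      have yA: "y \<in> ?A" using y by (simp add: cyl_def)
      have "(?\<sigma> ^^ n) y \<alpha> = (?\<sigma> ^^ n) x \<alpha>" if "\<alpha> \<in> F" for \<alpha>
        using that F(2) y
        by (auto simp: gen_shift_funpow [OF \<psi> yA] gen_shift_funpow [OF \<psi> x] cyl_def G_def)
      then show ?thesis using U(2) gen_shift_funpow_in [OF \<psi> yA] by blast
    qed
    then have "cyl x \<subseteq> V \<inter> {y \<in> topspace ?X. (?\<sigma> ^^ n) y \<in> U}"
      using V(2) by (auto simp: cyl_def)
    with V(1) U(1) show ?case
      by (auto simp: cover_join_def cover_preimage_def)
  qed
  have bound: "cover_number ?X (iterated_join ?X ?\<sigma> \<U> n) \<le> card (G \<rightarrow>\<^sub>E carrier Y)" for n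
  proof -
    have "\<forall>x\<in>?A. \<exists>V. V \<in> iterated_join ?X ?\<sigma> \<U> n \<and> cyl x \<subseteq> V"
      using sub by blast
    from bchoice [OF this]
    obtain V where V: "\<And>x. x \<in> ?A \<Longrightarrow> V x \<in> iterated_join ?X ?\<sigma> \<U> n" "\<And>x. x \<in> ?A \<Longrightarrow> cyl x \<subseteq> V x"
      by blast
    \<comment> \<open>One cylinder per pattern on \<open>G\<close>: \<open>rep w\<close> is a point with that pattern, so at most
      \<open>card (G \<rightarrow>\<^sub>E carrier Y)\<close> sets are selected.\<close>
    define rep where "rep w = (SOME x. x \<in> ?A \<and> restrict x G = w)" for w
    have rep: "rep (restrict x G) \<in> ?A \<and> restrict (rep (restrict x G)) G = restrict x G" if "x \<in> ?A" for x
      unfolding rep_def by (rule someI [of _ x]) (use that in auto)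
    let ?R = "(\<lambda>x. restrict x G) ` ?A" and ?\<V> = "(\<lambda>w. V (rep w)) ` (\<lambda>x. restrict x G) ` ?A"
    have G\<Gamma>: "G \<subseteq> \<Gamma>" using F(2) funpow_in [OF \<psi>] by (auto simp: G_def)
    have R: "?R \<subseteq> G \<rightarrow>\<^sub>E carrier Y" using G\<Gamma> by (auto simp: PiE_iff)
    have finR: "finite (G \<rightarrow>\<^sub>E carrier Y)" using finG finY by (simp add: finite_PiE)
    have \<V>: "?\<V> \<subseteq> iterated_join ?X ?\<sigma> \<U> n" using V(1) rep by auto
    moreover have "\<Union>?\<V> = topspace ?X"
    proof
      show "\<Union>?\<V> \<subseteq> topspace ?X"
        using \<V> iterated_join_subset by (intro Union_least) (rule iterated_join_subset, rule subsetD)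
      show "topspace ?X \<subseteq> \<Union>?\<V>"
      proof
        fix x assume "x \<in> topspace ?X"
        then have x: "x \<in> ?A" by simp
        have "rep (restrict x G) \<alpha> = x \<alpha>" if "\<alpha> \<in> G" for \<alpha>
          using fun_cong [OF conjunct2 [OF rep [OF x]], of \<alpha>] that by simp
        then have "x \<in> cyl (rep (restrict x G))"
          using x by (simp add: cyl_def)
        then have "x \<in> V (rep (restrict x G))"
          using V(2) [OF conjunct1 [OF rep [OF x]]] by (rule subsetD [rotated])
        with x show "x \<in> \<Union>?\<V>" by (intro UnionI [of "V (rep (restrict x G))"] imageI)
      qed
    qed
    moreover have "finite ?R" using R finR by (rule finite_subset)
    then have "finite ?\<V>" by blast
    ultimately have "cover_number ?X (iterated_join ?X ?\<sigma> \<U> n) \<le> card ?\<V>"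
      by (intro cover_number_le_card)
    also have "\<dots> \<le> card ?R" using \<open>finite ?R\<close> by (rule card_image_le)
    also have "\<dots> \<le> card (G \<rightarrow>\<^sub>E carrier Y)" using finR R by (rule card_mono)
    finally show ?thesis .
  qed
  then show "lim (\<lambda>n. ereal (ln (real (cover_number ?X (iterated_join ?X ?\<sigma> \<U> n))) / real n)) \<le> 0"
    by (intro eq_refl lim_bounded_ln [OF bound])
qed

section \<open>Vanishing algebraic entropy\<close>

lemma finite_supported:
  assumes "finite F" "finite S"
  shows "finite {x \<in> \<Gamma> \<rightarrow>\<^sub>E S. \<forall>\<alpha>\<in>\<Gamma> - F. x \<alpha> = e}"
proof (rule inj_on_finite [of "\<lambda>x. restrict x (F \<inter> \<Gamma>)" _ "F \<inter> \<Gamma> \<rightarrow>\<^sub>E S"])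
  show "inj_on (\<lambda>x. restrict x (F \<inter> \<Gamma>)) {x \<in> \<Gamma> \<rightarrow>\<^sub>E S. \<forall>\<alpha>\<in>\<Gamma> - F. x \<alpha> = e}"
  proof (rule inj_onI)
    fix x y
    assume x: "x \<in> {x \<in> \<Gamma> \<rightarrow>\<^sub>E S. \<forall>\<alpha>\<in>\<Gamma> - F. x \<alpha> = e}"
      and y: "y \<in> {x \<in> \<Gamma> \<rightarrow>\<^sub>E S. \<forall>\<alpha>\<in>\<Gamma> - F. x \<alpha> = e}"
      and eq: "restrict x (F \<inter> \<Gamma>) = restrict y (F \<inter> \<Gamma>)"
    show "x = y"
    proof (rule PiE_ext)
      show "x \<in> \<Gamma> \<rightarrow>\<^sub>E S" "y \<in> \<Gamma> \<rightarrow>\<^sub>E S" using x y by auto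
      show "x \<alpha> = y \<alpha>" if "\<alpha> \<in> \<Gamma>" for \<alpha>
        using x y fun_cong [OF eq, of \<alpha>] that by (cases "\<alpha> \<in> F") auto
    qed
  qed
  show "(\<lambda>x. restrict x (F \<inter> \<Gamma>)) ` {x \<in> \<Gamma> \<rightarrow>\<^sub>E S. \<forall>\<alpha>\<in>\<Gamma> - F. x \<alpha> = e} \<subseteq> F \<inter> \<Gamma> \<rightarrow>\<^sub>E S"
    by (intro image_subsetI PiE_I) auto
  show "finite (F \<inter> \<Gamma> \<rightarrow>\<^sub>E S)"
    using assms by (simp add: finite_PiE)
qed

text \<open>If all backward orbits are finite, the supports of all \<open>\<sigma>\<^sup>n x\<close> with \<open>x\<close> in a finite subgroup \<open>H\<close> lie in
  one finite set \<open>F\<close>, and the trajectories of \<open>H\<close> stay in the finite group \<open>K\<close> of families supported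
  on \<open>F\<close>.\<close>

lemma shift_alg_le_0:
  assumes cl: "shift_class Y \<Gamma> \<psi>"
    and bwd: "\<And>\<alpha>. \<alpha> \<in> \<Gamma> \<Longrightarrow> finite (\<Union>n. {\<beta> \<in> \<Gamma>. (\<psi> ^^ n) \<beta> = \<alpha>})"
  shows "shift_alg Y \<Gamma> \<psi> \<le> 0"
  unfolding shift_alg_def ent_alg_def
proof (rule SUP_least)
  interpret group Y using cl by (simp add: shift_class_def)
  have \<psi>: "\<psi> \<in> \<Gamma> \<rightarrow> \<Gamma>" and finY: "finite (carrier Y)"
    using cl by (auto simp: shift_class_def)
  let ?G = "sum_group \<Gamma> (\<lambda>_. Y)" and ?\<sigma> = "gen_shift \<Gamma> \<psi>"
  have carrier: "carrier ?G = {x \<in> \<Gamma> \<rightarrow>\<^sub>E carrier Y. finite {\<alpha> \<in> \<Gamma>. x \<alpha> \<noteq> \<one>\<^bsub>Y\<^esub>}}"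
    by (rule carrier_sum_group) (rule is_group)
  fix H assume "H \<in> {H. subgroup H ?G \<and> finite H}"
  then have H: "H \<subseteq> carrier ?G" "finite H" by (auto dest: subgroup.subset)
  define F where "F = (\<Union>x\<in>H. \<Union>\<alpha>\<in>{\<alpha> \<in> \<Gamma>. x \<alpha> \<noteq> \<one>\<^bsub>Y\<^esub>}. \<Union>n. {\<beta> \<in> \<Gamma>. (\<psi> ^^ n) \<beta> = \<alpha>})"
  have finF: "finite F"
    unfolding F_def
  proof (rule finite_UN_I [OF H(2)], rule finite_UN_I)
    show "finite {\<alpha> \<in> \<Gamma>. x \<alpha> \<noteq> \<one>\<^bsub>Y\<^esub>}" if "x \<in> H" for x
      using H that carrier by blast
  qed (use bwd in blast)
  define K where "K = {x \<in> \<Gamma> \<rightarrow>\<^sub>E carrier Y. \<forall>\<alpha>\<in>\<Gamma> - F. x \<alpha> = \<one>\<^bsub>Y\<^esub>}"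
  have finK: "finite K" unfolding K_def by (rule finite_supported [OF finF finY])
  have HK: "(?\<sigma> ^^ n) x \<in> K" if x: "x \<in> H" for x n
  proof -
    have xA: "x \<in> \<Gamma> \<rightarrow>\<^sub>E carrier Y" using x H by (auto simp: carrier)
    have "(?\<sigma> ^^ n) x \<beta> = \<one>\<^bsub>Y\<^esub>" if \<beta>: "\<beta> \<in> \<Gamma> - F" for \<beta>
    proof (rule ccontr)
      assume "\<not> ?thesis"
      then have "x ((\<psi> ^^ n) \<beta>) \<noteq> \<one>\<^bsub>Y\<^esub>"
        using \<beta> by (simp add: gen_shift_funpow [OF \<psi> xA])
      then have "\<beta> \<in> F" using x \<beta> funpow_in [OF \<psi>, of \<beta> n] by (auto simp: F_def)
      with \<beta> show False by simp
    qed
    then show ?thesis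
      unfolding K_def using gen_shift_funpow_in [OF \<psi> xA] by blast
  qed
  have "alg_trajectory ?G ?\<sigma> H n \<subseteq> K" for n
  proof (induction n)
    case 0
    show ?case by (auto simp: K_def)
  next
    case (Suc n)
    have "x \<otimes>\<^bsub>?G\<^esub> y \<in> K" if "x \<in> K" "y \<in> K" for x y
      using that by (auto simp: K_def PiE_iff)
    then show ?case using Suc HK by (fastforce simp: set_mult_def simp del: mult_sum_group)
  qed
  then have bound: "card (alg_trajectory ?G ?\<sigma> H n) \<le> card K" for n
    using finK by (intro card_mono) auto
  then show "lim (\<lambda>n. ereal (ln (real (card (alg_trajectory ?G ?\<sigma> H n))) / real n)) \<le> 0"
    by (intro eq_refl lim_bounded_ln [OF bound])
qed

section \<open>Comparison of the four entropies\<close>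

lemma shift_cset_le_0_if_periodic:
  fixes Y :: "('y, 'b) monoid_scheme" and \<Gamma> :: "'i set"
  assumes cl: "shift_class Y \<Gamma> \<psi>" and "P > 0"
    and per: "\<And>\<alpha>. \<alpha> \<in> \<Gamma> \<Longrightarrow> (\<psi> ^^ M) \<alpha> = (\<psi> ^^ (M + P)) \<alpha>"
  shows "shift_cset Y \<Gamma> \<psi> \<le> 0"
  unfolding shift_cset_def
proof (rule ent_cset_le_0)
  let ?A = "\<Gamma> \<rightarrow>\<^sub>E carrier Y" and ?\<sigma> = "gen_shift \<Gamma> \<psi>"
  have \<psi>: "\<psi> \<in> \<Gamma> \<rightarrow> \<Gamma>" and ff: "finite_fibre ?A ?\<sigma>"
    using cl by (simp_all add: shift_class_def)
  have in_A: "?\<sigma> \<in> ?A \<rightarrow> ?A" using \<psi> by (rule gen_shift_in)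
  fix D :: "('i \<Rightarrow> 'y) set" assume D: "finite D"
  have per_\<sigma>: "(?\<sigma> ^^ M) x = (?\<sigma> ^^ (M + P)) x" if x: "x \<in> ?A" for x
    unfolding gen_shift_funpow [OF \<psi> x] using per by (intro restrict_ext) simp
  have "(\<Union>i. {x \<in> surjective_core ?A ?\<sigma>. (?\<sigma> ^^ i) x \<in> D}) \<subseteq> (\<Union>i<M + P. {x \<in> ?A. (?\<sigma> ^^ i) x \<in> D})"
  proof clarify
    fix x i assume x: "x \<in> surjective_core ?A ?\<sigma>" and i: "(?\<sigma> ^^ i) x \<in> D"
    have xA: "x \<in> ?A" using x surjective_core_subset [OF in_A] by blast
    obtain j where "j < M + P" "(?\<sigma> ^^ i) x = (?\<sigma> ^^ j) x"
      using funpow_reduce [OF _ per_\<sigma> [OF xA], of i] \<open>P > 0\<close> by auto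
    with xA i show "x \<in> (\<Union>i<M + P. {x \<in> ?A. (?\<sigma> ^^ i) x \<in> D})" by auto
  qed
  moreover have "finite (\<Union>i<M + P. {x \<in> ?A. (?\<sigma> ^^ i) x \<in> D})"
    using finite_preimage_funpow [OF ff in_A D] by (intro finite_UN_I) auto
  ultimately show "finite (\<Union>i. {x \<in> surjective_core ?A ?\<sigma>. (?\<sigma> ^^ i) x \<in> D})"
    by (rule finite_subset)
qed

lemma shift_alg_le_0_if_periodic:
  assumes cl: "shift_class Y \<Gamma> \<psi>" and "P > 0"
    and per: "\<And>\<alpha>. \<alpha> \<in> \<Gamma> \<Longrightarrow> (\<psi> ^^ M) \<alpha> = (\<psi> ^^ (M + P)) \<alpha>"
  shows "shift_alg Y \<Gamma> \<psi> \<le> 0"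
proof (rule shift_alg_le_0 [OF cl])
  have \<psi>: "\<psi> \<in> \<Gamma> \<rightarrow> \<Gamma>" and ff: "finite_fibre \<Gamma> \<psi>"
    using cl by (simp_all add: shift_class_def)
  fix \<alpha> assume "\<alpha> \<in> \<Gamma>"
  have "(\<Union>n. {\<beta> \<in> \<Gamma>. (\<psi> ^^ n) \<beta> = \<alpha>}) \<subseteq> (\<Union>n<M + P. {\<beta> \<in> \<Gamma>. (\<psi> ^^ n) \<beta> \<in> {\<alpha>}})"
  proof clarify
    fix \<beta> n assume \<beta>: "\<beta> \<in> \<Gamma>"
    obtain j where "j < M + P" "(\<psi> ^^ n) \<beta> = (\<psi> ^^ j) \<beta>"
      using funpow_reduce [OF _ per [OF \<beta>], of n] \<open>P > 0\<close> by auto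
    with \<beta> show "\<beta> \<in> (\<Union>m<M + P. {\<gamma> \<in> \<Gamma>. (\<psi> ^^ m) \<gamma> \<in> {(\<psi> ^^ n) \<beta>}})" by auto
  qed
  moreover have "finite (\<Union>n<M + P. {\<beta> \<in> \<Gamma>. (\<psi> ^^ n) \<beta> \<in> {\<alpha>}})"
    using finite_preimage_funpow [OF ff \<psi>, of "{\<alpha>}"] by (intro finite_UN_I) auto
  ultimately show "finite (\<Union>n. {\<beta> \<in> \<Gamma>. (\<psi> ^^ n) \<beta> = \<alpha>})"
    by (rule finite_subset)
qed

text \<open>The dichotomy behind all upper bounds by \<open>s\<close>.\<close>

lemma periodic_if_shift_set_finite:
  assumes cl: "shift_class Y \<Gamma> \<psi>" and fin: "shift_set Y \<Gamma> \<psi> \<noteq> \<infinity>"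
  obtains M P where "P > 0" "\<And>\<alpha>. \<alpha> \<in> \<Gamma> \<Longrightarrow> (\<psi> ^^ M) \<alpha> = (\<psi> ^^ (M + P)) \<alpha>"
proof -
  have \<psi>: "\<psi> \<in> \<Gamma> \<rightarrow> \<Gamma>" using cl by (simp add: shift_class_def)
  obtain i j where "i < j" "finite {\<alpha> \<in> \<Gamma>. (\<psi> ^^ i) \<alpha> \<noteq> (\<psi> ^^ j) \<alpha>}"
    using shift_set_eq_infinity [OF cl] fin by blast
  from funpow_eq_if_disagreement_finite [OF this \<psi>] that show thesis by blast
qed

lemma shift_set_nonneg: "0 \<le> shift_set Y \<Gamma> \<psi>"
  using ent_set_ge_card [of "{}" "\<Gamma> \<rightarrow>\<^sub>E carrier Y" "gen_shift \<Gamma> \<psi>"]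
  by (simp add: shift_set_def zero_ereal_def)

lemma shift_cset_le_set:
  assumes cl: "shift_class Y \<Gamma> \<psi>"
  shows "shift_cset Y \<Gamma> \<psi> \<le> shift_set Y \<Gamma> \<psi>"
proof (cases "shift_set Y \<Gamma> \<psi> = \<infinity>")
  case False
  obtain P M where MP: "P > 0" "\<And>\<alpha>. \<alpha> \<in> \<Gamma> \<Longrightarrow> (\<psi> ^^ M) \<alpha> = (\<psi> ^^ (M + P)) \<alpha>"
    by (rule periodic_if_shift_set_finite [OF cl False]) blast
  have "shift_cset Y \<Gamma> \<psi> \<le> 0"
    by (rule shift_cset_le_0_if_periodic [OF cl MP])
  then show ?thesis using shift_set_nonneg by (rule order_trans)
qed simp

lemma shift_alg_le_set:
  assumes cl: "shift_class Y \<Gamma> \<psi>"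
  shows "shift_alg Y \<Gamma> \<psi> \<le> shift_set Y \<Gamma> \<psi>"
proof (cases "shift_set Y \<Gamma> \<psi> = \<infinity>")
  case False
  obtain P M where MP: "P > 0" "\<And>\<alpha>. \<alpha> \<in> \<Gamma> \<Longrightarrow> (\<psi> ^^ M) \<alpha> = (\<psi> ^^ (M + P)) \<alpha>"
    by (rule periodic_if_shift_set_finite [OF cl False]) blast
  have "shift_alg Y \<Gamma> \<psi> \<le> 0"
    by (rule shift_alg_le_0_if_periodic [OF cl MP])
  then show ?thesis using shift_set_nonneg by (rule order_trans)
qed simp

text \<open>Both sides are governed by infinite orbits of \<open>\<psi>\<close>: one of them makes the right-hand side infinite,
  and without them the left-hand side vanishes.\<close>

lemma shift_top_le_cset:
  assumes cl: "shift_class Y \<Gamma> \<psi>"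
  shows "shift_top Y \<Gamma> \<psi> \<le> shift_cset Y \<Gamma> \<psi>"
proof (cases "\<exists>\<alpha>\<in>\<Gamma>. inj (\<lambda>n. (\<psi> ^^ n) \<alpha>)")
  case True
  then show ?thesis using shift_cset_eq_infinity [OF cl] by force
next
  case False
  have "shift_top Y \<Gamma> \<psi> \<le> 0"
  proof (rule shift_top_le_0 [OF cl])
    fix \<alpha> assume "\<alpha> \<in> \<Gamma>"
    with False have "\<not> inj (\<lambda>n. (\<psi> ^^ n) \<alpha>)" by blast
    then show "finite (range (\<lambda>n. (\<psi> ^^ n) \<alpha>))" by (rule finite_orbit_if_not_inj)
  qed
  also have "0 \<le> shift_cset Y \<Gamma> \<psi>"
    unfolding shift_cset_def by (rule ent_cset_nonneg)
  finally show ?thesis .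
qed

section \<open>Binary shifts over the natural numbers\<close>

definition Z2 :: "nat monoid" where
  "Z2 = \<lparr>carrier = {0, 1}, monoid.mult = (\<lambda>x y. (x + y) mod 2), one = 0\<rparr>"

lemma Z2_simps [simp]:
  "carrier Z2 = {0, 1}" "x \<otimes>\<^bsub>Z2\<^esub> y = (x + y) mod 2" "\<one>\<^bsub>Z2\<^esub> = 0"
  by (simp_all add: Z2_def)

lemma comm_group_Z2: "comm_group Z2"
proof (rule comm_groupI)
  show "\<exists>y\<in>carrier Z2. y \<otimes>\<^bsub>Z2\<^esub> x = \<one>\<^bsub>Z2\<^esub>" if "x \<in> carrier Z2" for x
    using that by (intro bexI [of _ x]) auto
qed (auto simp: add.commute)

lemma group_Z2: "group Z2"
  using comm_group_Z2 by (rule comm_group.axioms(2))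

text \<open>A point \<open>x\<close> is determined by \<open>\<sigma> x\<close> outside \<open>\<Gamma> - \<psi> ` \<Gamma>\<close>.\<close>

lemma finite_fibre_gen_shift:
  assumes "finite (\<Gamma> - \<psi> ` \<Gamma>)" "finite S"
  shows "finite_fibre (\<Gamma> \<rightarrow>\<^sub>E S) (gen_shift \<Gamma> \<psi>)"
  unfolding finite_fibre_def
proof
  fix y
  let ?R = "\<lambda>x. restrict x (\<Gamma> - \<psi> ` \<Gamma>)"
  show "finite {x \<in> \<Gamma> \<rightarrow>\<^sub>E S. gen_shift \<Gamma> \<psi> x = y}"
  proof (rule inj_on_finite [of ?R _ "\<Gamma> - \<psi> ` \<Gamma> \<rightarrow>\<^sub>E S"])
    show "inj_on ?R {x \<in> \<Gamma> \<rightarrow>\<^sub>E S. gen_shift \<Gamma> \<psi> x = y}"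
    proof (rule inj_onI)
      fix u v
      assume u: "u \<in> {x \<in> \<Gamma> \<rightarrow>\<^sub>E S. gen_shift \<Gamma> \<psi> x = y}"
        and v: "v \<in> {x \<in> \<Gamma> \<rightarrow>\<^sub>E S. gen_shift \<Gamma> \<psi> x = y}"
        and eq: "?R u = ?R v"
      have eq': "gen_shift \<Gamma> \<psi> u = gen_shift \<Gamma> \<psi> v" using u v by simp
      have "u \<beta> = v \<beta>" if \<beta>: "\<beta> \<in> \<Gamma>" for \<beta>
      proof (cases "\<beta> \<in> \<psi> ` \<Gamma>")
        case True
        then obtain \<alpha> where "\<alpha> \<in> \<Gamma>" "\<beta> = \<psi> \<alpha>" by blast
        then show ?thesis using fun_cong [OF eq', of \<alpha>] by (simp add: gen_shift_def)
      next
        case False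
        then show ?thesis using fun_cong [OF eq, of \<beta>] \<beta> by simp
      qed
      then show "u = v" using u v by (intro PiE_ext [of u \<Gamma> "\<lambda>_. S" v]) auto
    qed
    show "?R ` {x \<in> \<Gamma> \<rightarrow>\<^sub>E S. gen_shift \<Gamma> \<psi> x = y} \<subseteq> \<Gamma> - \<psi> ` \<Gamma> \<rightarrow>\<^sub>E S"
      by (intro image_subsetI PiE_I) auto
    show "finite (\<Gamma> - \<psi> ` \<Gamma> \<rightarrow>\<^sub>E S)" using assms by (intro finite_PiE) auto
  qed
qed

lemma shift_class_Z2:
  fixes \<psi> :: "nat \<Rightarrow> nat"
  assumes "\<And>m. finite {n. \<psi> n = m}" "finite (- range \<psi>)"
  shows "shift_class Z2 UNIV \<psi>"
  using assms group_Z2 finite_fibre_gen_shift [of UNIV \<psi> "carrier Z2"]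
  by (auto simp: shift_class_def finite_fibre_def Compl_eq_Diff_UNIV)

lemma shift_class_Suc: "shift_class Z2 UNIV Suc"
proof (rule shift_class_Z2)
  show "finite {n. Suc n = m}" for m
    by (rule finite_subset [of _ "{..m}"]) auto
  have "- range Suc = {0}" using not0_implies_Suc by auto
  then show "finite (- range Suc)" by simp
qed

lemma shift_alg_Suc: "shift_alg Z2 UNIV Suc \<le> 0"
proof (rule shift_alg_le_0 [OF shift_class_Suc])
  fix \<alpha> :: nat
  show "finite (\<Union>n. {\<beta> \<in> UNIV. (Suc ^^ n) \<beta> = \<alpha>})"
    by (rule finite_subset [of _ "{..\<alpha>}"]) auto
qed

lemma cover_number_partition:
  assumes "finite \<U>" "\<Union>\<U> = topspace X" "{} \<notin> \<U>" "disjoint \<U>"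
  shows "cover_number X \<U> = card \<U>"
proof -
  have "\<V> = \<U>" if "\<V> \<subseteq> \<U>" "\<Union>\<V> = topspace X" for \<V>
  proof -
    have "U \<in> \<V>" if U: "U \<in> \<U>" for U
    proof -
      obtain x where x: "x \<in> U" using U assms(3) by fastforce
      then obtain V where V: "V \<in> \<V>" "x \<in> V" using U assms(2) \<open>\<Union>\<V> = topspace X\<close> by blast
      then have "V = U"
        using disjointD [OF assms(4) _ U, of V] \<open>\<V> \<subseteq> \<U>\<close> x by blast
      with V show ?thesis by simp
    qed
    with \<open>\<V> \<subseteq> \<U>\<close> show ?thesis by blast
  qed
  then show ?thesis
    unfolding cover_number_def using assms(1,2) by (intro Least_equality) auto
qed

text \<open>For the one-sided full shift the cover by the value at \<open>0\<close> has as iterated joins the partitions into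
  the \<open>2\<^sup>n\<close> cylinders of length \<open>n\<close>, which gives the lower bound \<open>ln 2\<close>.\<close>

lemma shift_top_Suc: "0 < shift_top Z2 UNIV Suc"
proof -
  define X where "X = product_topology (\<lambda>_ :: nat. discrete_topology (carrier Z2)) UNIV"
  let ?\<sigma> = "gen_shift (UNIV :: nat set) Suc :: (nat \<Rightarrow> nat) \<Rightarrow> nat \<Rightarrow> nat"
  define A :: "(nat \<Rightarrow> nat) set" where "A = UNIV \<rightarrow>\<^sub>E {0, 1}"
  have top: "topspace X = A" by (simp add: A_def X_def)
  define \<U> where "\<U> = (\<lambda>b. {x \<in> A. x 0 = b}) ` {0, 1}"
  have A_iff: "x \<in> A \<longleftrightarrow> (\<forall>i. x i \<in> {0, 1})" for x by (simp add: A_def PiE_iff)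
  have "openin X {x \<in> A. x 0 = b}" if "b \<in> {0, 1}" for b
  proof -
    have "openin X {x \<in> topspace X. x 0 \<in> {b}}"
    proof (rule openin_continuous_map_preimage)
      show "continuous_map X (discrete_topology (carrier Z2)) (\<lambda>x. x 0)"
        unfolding X_def by (rule continuous_map_product_projection) simp
      show "openin (discrete_topology (carrier Z2)) {b}" using that by simp
    qed
    then show ?thesis by (simp add: top)
  qed
  then have "\<forall>U\<in>\<U>. openin X U" unfolding \<U>_def by blast
  moreover have "\<Union>\<U> = A" unfolding \<U>_def using A_iff by blast
  moreover have "finite \<U>" by (simp add: \<U>_def)
  ultimately have cover: "finite_open_cover X \<U>"
    unfolding finite_open_cover_def top by (intro conjI)
  have pow: "(?\<sigma> ^^ n) x = (\<lambda>i. x (i + n))" if "x \<in> A" for x n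
    using gen_shift_funpow [of Suc UNIV x "{0, 1}" n] that
    by (simp add: A_def add.commute restrict_def)
  define cyl where "cyl n w = {x \<in> A. \<forall>i<n. x i = w i}" for n and w :: "nat \<Rightarrow> nat"
  have J: "iterated_join X ?\<sigma> \<U> n = cyl n ` ({..<n} \<rightarrow>\<^sub>E {0, 1})" for n
  proof (induction n)
    case 0
    show ?case by (simp add: cyl_def top)
  next
    case (Suc n)
    have pre: "{x \<in> topspace X. (?\<sigma> ^^ n) x \<in> {x \<in> A. x 0 = b}} = {x \<in> A. x n = b}" for b
      by (auto simp: top pow A_iff)
    have pre_cover: "cover_preimage X (?\<sigma> ^^ n) \<U> = (\<lambda>b. {x \<in> A. x n = b}) ` {0, 1}"
      unfolding cover_preimage_def \<U>_def image_image pre ..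
    have step: "cyl n w \<inter> {x \<in> A. x n = b} = cyl (Suc n) (w(n := b))" for w b
      by (auto simp: cyl_def less_Suc_eq)
    have comprehension: "{f w b |w b. w \<in> W \<and> b \<in> B} = (\<lambda>(b, w). f w b) ` (B \<times> W)"
      for f :: "(nat \<Rightarrow> nat) \<Rightarrow> nat \<Rightarrow> (nat \<Rightarrow> nat) set" and W B
      by auto
    have "iterated_join X ?\<sigma> \<U> (Suc n)
        = {cyl n w \<inter> {x \<in> A. x n = b} |w b. w \<in> {..<n} \<rightarrow>\<^sub>E {0, 1} \<and> b \<in> {0, 1}}"
      unfolding iterated_join.simps(2) Suc pre_cover cover_join_def
      by blast
    also have "\<dots> = (\<lambda>(b, w). cyl (Suc n) (w(n := b))) ` ({0, 1} \<times> ({..<n} \<rightarrow>\<^sub>E {0, 1}))"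
      unfolding step by (rule comprehension)
    also have "\<dots> = cyl (Suc n) ` ({..<Suc n} \<rightarrow>\<^sub>E {0, 1})"
      by (simp only: lessThan_Suc PiE_insert_eq image_image case_prod_beta')
    finally show ?case .
  qed
  have inh: "(\<lambda>i. if i < n then w i else 0) \<in> cyl n w" if "w \<in> {..<n} \<rightarrow>\<^sub>E {0, 1}" for n w
    using PiE_mem [OF that] by (auto simp: cyl_def A_iff)
  have sep: "v = w" if "v \<in> {..<n} \<rightarrow>\<^sub>E {0, 1}" "w \<in> {..<n} \<rightarrow>\<^sub>E {0, 1}"
      and "x \<in> cyl n v" "x \<in> cyl n w" for n v w and x
    using that(1,2) by (rule PiE_ext) (use that(3,4) in \<open>auto simp: cyl_def\<close>)
  have "cover_number X (iterated_join X ?\<sigma> \<U> n) = 2 ^ n" for n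
  proof -
    let ?W = "{..<n} \<rightarrow>\<^sub>E {0, 1 :: nat}"
    have "inj_on (cyl n) ?W"
      using inh sep by (intro inj_onI) metis
    then have "card (cyl n ` ?W) = 2 ^ n" by (simp add: card_image card_funcsetE numeral_2_eq_2)
    moreover have "cover_number X (cyl n ` ?W) = card (cyl n ` ?W)"
    proof (rule cover_number_partition)
      show "finite (cyl n ` ?W)" by (simp add: finite_PiE)
      show "\<Union>(cyl n ` ?W) = topspace X"
      proof
        show "\<Union>(cyl n ` ?W) \<subseteq> topspace X" unfolding top by (auto simp: cyl_def)
        show "topspace X \<subseteq> \<Union>(cyl n ` ?W)"
        proof
          fix x assume "x \<in> topspace X"
          then have "x \<in> A" by (simp only: top)
          then have "restrict x {..<n} \<in> ?W" "x \<in> cyl n (restrict x {..<n})"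
            by (auto simp: A_iff cyl_def)
          then show "x \<in> \<Union>(cyl n ` ?W)" by blast
        qed
      qed
      show "{} \<notin> cyl n ` ?W" using inh by blast
      show "disjoint (cyl n ` ?W)" using sep by (intro disjointI) blast
    qed
    ultimately show ?thesis by (simp only: J)
  qed
  then have "ln (real (cover_number X (iterated_join X ?\<sigma> \<U> n))) / real n = (if n = 0 then 0 else ln 2)" for n
    by (simp add: ln_realpow)
  then have "lim (\<lambda>n. ereal (ln (real (cover_number X (iterated_join X ?\<sigma> \<U> n))) / real n)) = ereal (ln 2)"
    by (intro limI tendsto_eventually eventually_mono [OF eventually_gt_at_top [of 0]]) simp
  moreover have "lim (\<lambda>n. ereal (ln (real (cover_number X (iterated_join X ?\<sigma> \<U> n))) / real n))
      \<le> shift_top Z2 UNIV Suc"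
    unfolding shift_top_def ent_top_def X_def [symmetric] by (rule SUP_upper) (simp add: cover)
  ultimately have "ereal (ln 2) \<le> shift_top Z2 UNIV Suc" by simp
  moreover have "0 < ereal (ln 2)" by simp
  ultimately show ?thesis by (rule less_le_trans [rotated])
qed

definition pred :: "nat \<Rightarrow> nat" where
  "pred n = n - 1"

lemma pred_funpow: "(pred ^^ n) m = m - n"
  by (induction n) (simp_all add: pred_def)

lemma shift_class_pred: "shift_class Z2 UNIV pred"
proof (rule shift_class_Z2)
  show "finite {n. pred n = m}" for m
    by (rule finite_subset [of _ "{..Suc m}"]) (auto simp: pred_def)
  have "n \<in> range pred" for n by (rule range_eqI [of _ _ "Suc n"]) (simp add: pred_def)
  then have "- range pred = {}" by blast
  then show "finite (- range pred)" by simp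
qed

lemma shift_top_pred: "shift_top Z2 UNIV pred \<le> 0"
proof (rule shift_top_le_0 [OF shift_class_pred])
  fix \<alpha> :: nat
  show "finite (range (\<lambda>n. (pred ^^ n) \<alpha>))"
    by (rule finite_subset [of _ "{..\<alpha>}"]) (auto simp: pred_funpow)
qed

text \<open>Every \<open>i\<close> is moved to \<open>0\<close> eventually, so only constant sequences lie in the surjective core.\<close>

lemma shift_cset_pred: "shift_cset Z2 UNIV pred \<le> 0"
  unfolding shift_cset_def
proof (rule ent_cset_le_0)
  let ?A = "(UNIV :: nat set) \<rightarrow>\<^sub>E carrier Z2" and ?\<sigma> = "gen_shift UNIV pred :: (nat \<Rightarrow> nat) \<Rightarrow> nat \<Rightarrow> nat"
  have "surjective_core ?A ?\<sigma> \<subseteq> (\<lambda>b _. b) ` {0, 1}"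
  proof
    fix x assume x: "x \<in> surjective_core ?A ?\<sigma>"
    have eq: "x i = x 0 \<and> x 0 \<in> {0, 1}" for i
    proof -
      have "x \<in> (?\<sigma> ^^ Suc i) ` ?A"
        using INT_D [OF x [unfolded surjective_core_def], of "Suc i"] by simp
      then obtain y where y: "y \<in> ?A" and "x = (?\<sigma> ^^ Suc i) y" by blast
      then have "x = (\<lambda>j. y (j - Suc i))"
        using gen_shift_funpow [of pred UNIV y "carrier Z2" "Suc i"] by (simp add: pred_funpow restrict_def del: funpow.simps)
      then show ?thesis using PiE_mem [OF y, of 0] by simp
    qed
    then have "x = (\<lambda>_. x 0)" by blast
    then show "x \<in> (\<lambda>b _. b) ` {0, 1}" using eq by blast
  qed
  then have fin: "finite (surjective_core ?A ?\<sigma>)" by (rule finite_subset) simp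
  show "finite (\<Union>i. {x \<in> surjective_core ?A ?\<sigma>. (?\<sigma> ^^ i) x \<in> D})" for D
    by (rule finite_subset [OF _ fin]) blast
qed

text \<open>The \<open>n\<close>-th iterate moves the generator with support \<open>{1}\<close> to the one with support \<open>{n + 1}\<close>, and the
  trajectory consists of the \<open>2\<^sup>n\<close> elements supported in \<open>{1..n}\<close>.\<close>

lemma shift_alg_pred: "0 < shift_alg Z2 UNIV pred"
proof -
  let ?G = "sum_group (UNIV :: nat set) (\<lambda>_. Z2)"
    and ?\<sigma> = "gen_shift UNIV pred :: (nat \<Rightarrow> nat) \<Rightarrow> nat \<Rightarrow> nat"
  interpret G: group ?G by (rule sum_group) (rule group_Z2)
  define ind :: "nat set \<Rightarrow> nat \<Rightarrow> nat" where "ind S = (\<lambda>i. if i \<in> S then 1 else 0)" for S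
  have inj: "inj ind"
  proof (rule injI)
    fix S T assume "ind S = ind T"
    then have "i \<in> S \<longleftrightarrow> i \<in> T" for i by (simp add: ind_def fun_eq_iff split: if_splits) metis
    then show "S = T" by blast
  qed
  have ind_in: "ind S \<in> carrier ?G" if "finite S" for S
    using that by (auto simp: carrier_sum_group group_Z2 ind_def elim!: rev_finite_subset split: if_splits)
  have mult: "ind S \<otimes>\<^bsub>?G\<^esub> ind T = ind (sym_diff S T)" for S T
    by (auto simp: ind_def fun_eq_iff)
  have one: "\<one>\<^bsub>?G\<^esub> = ind {}" by (auto simp: ind_def fun_eq_iff)
  define H where "H = ind ` {{}, {1}}"
  have "subgroup H ?G"
  proof (rule G.subgroupI)
    show "H \<subseteq> carrier ?G" using ind_in by (auto simp: H_def)
    show "H \<noteq> {}" by (simp add: H_def)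
    show "inv\<^bsub>?G\<^esub> a \<in> H" if "a \<in> H" for a
    proof -
      obtain S where S: "S \<in> {{}, {1}}" and a: "a = ind S"
        using \<open>a \<in> H\<close> unfolding H_def by (rule imageE)
      have "finite S" using S by auto
      then have "a \<in> carrier ?G" unfolding a by (rule ind_in)
      moreover have "a \<otimes>\<^bsub>?G\<^esub> a = \<one>\<^bsub>?G\<^esub>"
        unfolding a mult one by simp
      ultimately have "inv\<^bsub>?G\<^esub> a = a" by (intro G.inv_equality)
      with that show ?thesis by simp
    qed
    show "a \<otimes>\<^bsub>?G\<^esub> b \<in> H" if "a \<in> H" "b \<in> H" for a b
      using that by (auto simp: H_def mult simp del: mult_sum_group)
  qed
  have shift: "(?\<sigma> ^^ n) (ind S) = (\<lambda>i. ind S (i - n))" for n S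
  proof -
    have "ind S \<in> UNIV \<rightarrow>\<^sub>E {0, 1}" by (simp add: ind_def PiE_iff)
    then show ?thesis
      using gen_shift_funpow [of pred UNIV "ind S" "{0, 1}" n] by (simp add: pred_funpow restrict_def)
  qed
  have "(?\<sigma> ^^ n) (ind {}) = ind {}" "(?\<sigma> ^^ n) (ind {1}) = ind {Suc n}" for n
    unfolding shift by (auto simp: ind_def fun_eq_iff)
  then have H_shift: "(?\<sigma> ^^ n) ` H = {ind {}, ind {Suc n}}" for n
    by (simp add: H_def)
  have traj: "alg_trajectory ?G ?\<sigma> H n = ind ` Pow {1..n}" for n
  proof (induction n)
    case 0
    show ?case by (simp add: one del: one_sum_group)
  next
    case (Suc n)
    have "alg_trajectory ?G ?\<sigma> H (Suc n) = (\<Union>S\<in>Pow {1..n}. {ind S \<otimes>\<^bsub>?G\<^esub> ind {}, ind S \<otimes>\<^bsub>?G\<^esub> ind {Suc n}})"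
      unfolding alg_trajectory.simps(2) Suc H_shift set_mult_def by blast
    also have "\<dots> = (\<Union>S\<in>Pow {1..n}. {ind S, ind (insert (Suc n) S)})"
    proof (rule SUP_cong [OF refl])
      fix S assume "S \<in> Pow {1..n}"
      then have "sym_diff S {Suc n} = insert (Suc n) S" by auto
      then show "{ind S \<otimes>\<^bsub>?G\<^esub> ind {}, ind S \<otimes>\<^bsub>?G\<^esub> ind {Suc n}} = {ind S, ind (insert (Suc n) S)}"
        unfolding mult by simp
    qed
    also have "\<dots> = ind ` Pow (insert (Suc n) {1..n})"
      unfolding Pow_insert by blast
    also have "insert (Suc n) {1..n} = {1..Suc n}" by auto
    finally show ?case .
  qed
  have "card (alg_trajectory ?G ?\<sigma> H n) = 2 ^ n" for n
    unfolding traj using inj by (simp add: card_image inj_on_subset card_Pow)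
  then have "ln (real (card (alg_trajectory ?G ?\<sigma> H n))) / real n = (if n = 0 then 0 else ln 2)" for n
    by (simp add: ln_realpow)
  then have "lim (\<lambda>n. ereal (ln (real (card (alg_trajectory ?G ?\<sigma> H n))) / real n)) = ereal (ln 2)"
    by (intro limI tendsto_eventually eventually_mono [OF eventually_gt_at_top [of 0]]) simp
  moreover have "lim (\<lambda>n. ereal (ln (real (card (alg_trajectory ?G ?\<sigma> H n))) / real n)) \<le> shift_alg Z2 UNIV pred"
    unfolding shift_alg_def ent_alg_def
    by (rule SUP_upper) (use \<open>subgroup H ?G\<close> in \<open>simp add: H_def\<close>)
  ultimately have "ereal (ln 2) \<le> shift_alg Z2 UNIV pred" by simp
  moreover have "0 < ereal (ln 2)" by simp
  ultimately show ?thesis by (rule less_le_trans [rotated])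
qed

text \<open>Row \<open>k\<close> of the plane is rotated along its first \<open>k + 1\<close> entries. All orbits are finite, yet there is
  no common period.\<close>

definition rotate_row :: "nat \<times> nat \<Rightarrow> nat \<times> nat" where
  "rotate_row = (\<lambda>(k, r). (k, if r < k then Suc r else if r = k then 0 else r))"

definition cycles :: "nat \<Rightarrow> nat" where
  "cycles n = prod_encode (rotate_row (prod_decode n))"

lemma cycles_encode:
  "cycles (prod_encode (k, r)) = prod_encode (k, if r < k then Suc r else if r = k then 0 else r)"
  by (simp add: cycles_def rotate_row_def)

lemma bij_cycles: "bij cycles"
proof -
  have "bij rotate_row"
    by (rule o_bij [of "\<lambda>(k, r). (k, if r = 0 then k else if r \<le> k then r - 1 else r)"])
       (auto simp: rotate_row_def fun_eq_iff)
  then have "bij (prod_encode \<circ> (rotate_row \<circ> prod_decode))"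
    by (intro bij_comp bij_prod_encode bij_prod_decode)
  then show ?thesis by (simp add: cycles_def [abs_def] comp_def)
qed

lemma shift_class_cycles: "shift_class Z2 UNIV cycles"
proof (rule shift_class_Z2)
  show "finite {n. cycles n = m}" for m
    using finite_vimageI [of "{m}" cycles] bij_cycles by (simp add: vimage_def bij_is_inj)
  show "finite (- range cycles)"
    using bij_is_surj [OF bij_cycles] by simp
qed

lemma shift_top_cycles: "shift_top Z2 UNIV cycles \<le> 0"
proof (rule shift_top_le_0 [OF shift_class_cycles])
  fix \<alpha> :: nat
  obtain k r where \<alpha>: "\<alpha> = prod_encode (k, r)"
    by (metis prod_decode_inverse surj_pair)
  have "(cycles ^^ n) \<alpha> \<in> (\<lambda>s. prod_encode (k, s)) ` {..max k r}" for n
  proof (induction n)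
    case 0
    show ?case by (simp add: \<alpha>)
  next
    case (Suc n)
    then obtain s where "s \<le> max k r" "(cycles ^^ n) \<alpha> = prod_encode (k, s)" by auto
    then show ?case by (auto simp: cycles_encode)
  qed
  then have "range (\<lambda>n. (cycles ^^ n) \<alpha>) \<subseteq> (\<lambda>s. prod_encode (k, s)) ` {..max k r}" by blast
  then show "finite (range (\<lambda>n. (cycles ^^ n) \<alpha>))" by (rule finite_subset) simp
qed

lemma surjective_core_eq_if_onto:
  assumes "g ` A = A"
  shows "surjective_core A g = A"
proof -
  have "(g ^^ n) ` A = A" for n
  proof (induction n)
    case (Suc n)
    have "(g ^^ Suc n) ` A = g ` (g ^^ n) ` A" by (simp add: image_image)
    then show ?case by (simp only: Suc assms)
  qed simp
  then show ?thesis by (auto simp: surjective_core_def)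
qed

text \<open>The indicator of column \<open>0\<close> is not periodic: its \<open>p\<close>-th iterate already differs from it in row \<open>p\<close>.
  Since \<open>\<sigma>\<close> is bijective, this single point has an infinite backward orbit.\<close>

lemma shift_cset_cycles: "0 < shift_cset Z2 UNIV cycles"
proof -
  let ?A = "(UNIV :: nat set) \<rightarrow>\<^sub>E carrier Z2" and ?\<sigma> = "gen_shift UNIV cycles :: (nat \<Rightarrow> nat) \<Rightarrow> nat \<Rightarrow> nat"
  have "?\<sigma> ` ?A = ?A"
  proof
    show "?\<sigma> ` ?A \<subseteq> ?A" by (intro funcset_image gen_shift_in) simp
    show "?A \<subseteq> ?\<sigma> ` ?A"
    proof
      fix y assume y: "y \<in> ?A"
      have "y = ?\<sigma> (y \<circ> inv_into UNIV cycles)"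
        by (simp add: gen_shift_def comp_def restrict_def bij_is_inj [OF bij_cycles])
      moreover have "y \<circ> inv_into UNIV cycles \<in> ?A" using y by (simp add: PiE_iff)
      ultimately show "y \<in> ?\<sigma> ` ?A" by blast
    qed
  qed
  then have core: "surjective_core ?A ?\<sigma> = ?A" by (rule surjective_core_eq_if_onto)
  define x where "x n = (if snd (prod_decode n) = 0 then 1 else 0 :: nat)" for n
  have x: "x \<in> ?A" by (simp add: x_def PiE_iff)
  have pow: "(cycles ^^ j) (prod_encode (k, 0)) = prod_encode (k, j)" if "j \<le> k" for j k
    using that by (induction j) (simp_all add: cycles_encode)
  have "p = 0" if "(?\<sigma> ^^ p) x = x" for p
  proof -
    have "(?\<sigma> ^^ p) x (prod_encode (p, 0)) = x (prod_encode (p, p))"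
      by (subst gen_shift_funpow [OF _ x]) (simp_all add: pow)
    then show ?thesis using that by (simp add: x_def split: if_splits)
  qed
  moreover have "{x} \<subseteq> surjective_core ?A ?\<sigma>" unfolding core using x by simp
  ultimately have "ereal (real (card {x})) \<le> shift_cset Z2 UNIV cycles"
    by (intro shift_cset_ge_card [OF shift_class_cycles]) simp_all
  then have "1 \<le> shift_cset Z2 UNIV cycles" by (simp add: one_ereal_def)
  then show ?thesis by (rule less_le_trans [rotated]) simp
qed

theorem mainTheorem4:
  shows
    "(\<forall>(Y :: ('y, 'b) monoid_scheme) (\<Gamma> :: 'i set) \<psi>. shift_class Y \<Gamma> \<psi> \<longrightarrow>
        shift_top Y \<Gamma> \<psi> \<le> shift_cset Y \<Gamma> \<psi> \<and>
        shift_top Y \<Gamma> \<psi> \<le> shift_set Y \<Gamma> \<psi> \<and>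
        (comm_group Y \<longrightarrow> shift_alg Y \<Gamma> \<psi> \<le> shift_set Y \<Gamma> \<psi>) \<and>
        shift_cset Y \<Gamma> \<psi> \<le> shift_set Y \<Gamma> \<psi> \<and>
        shift_top Y \<Gamma> \<psi> \<le> shift_top Y \<Gamma> \<psi> \<and>
        (comm_group Y \<longrightarrow> shift_alg Y \<Gamma> \<psi> \<le> shift_alg Y \<Gamma> \<psi>) \<and>
        shift_cset Y \<Gamma> \<psi> \<le> shift_cset Y \<Gamma> \<psi> \<and>
        shift_set Y \<Gamma> \<psi> \<le> shift_set Y \<Gamma> \<psi>) \<and>
     (\<exists>(Y :: nat monoid) (\<Gamma> :: nat set) \<psi>. shift_class Y \<Gamma> \<psi> \<and> comm_group Y \<and>
        shift_top Y \<Gamma> \<psi> > shift_alg Y \<Gamma> \<psi>) \<and>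
     (\<exists>(Y :: nat monoid) (\<Gamma> :: nat set) \<psi>. shift_class Y \<Gamma> \<psi> \<and> comm_group Y \<and>
        shift_alg Y \<Gamma> \<psi> > shift_top Y \<Gamma> \<psi>) \<and>
     (\<exists>(Y :: nat monoid) (\<Gamma> :: nat set) \<psi>. shift_class Y \<Gamma> \<psi> \<and> comm_group Y \<and>
        shift_alg Y \<Gamma> \<psi> > shift_cset Y \<Gamma> \<psi>) \<and>
     (\<exists>(Y :: nat monoid) (\<Gamma> :: nat set) \<psi>. shift_class Y \<Gamma> \<psi> \<and>
        shift_cset Y \<Gamma> \<psi> > shift_top Y \<Gamma> \<psi>) \<and>
     (\<exists>(Y :: nat monoid) (\<Gamma> :: nat set) \<psi>. shift_class Y \<Gamma> \<psi> \<and> comm_group Y \<and>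
        shift_cset Y \<Gamma> \<psi> > shift_alg Y \<Gamma> \<psi>) \<and>
     (\<exists>(Y :: nat monoid) (\<Gamma> :: nat set) \<psi>. shift_class Y \<Gamma> \<psi> \<and>
        shift_set Y \<Gamma> \<psi> > shift_top Y \<Gamma> \<psi>) \<and>
     (\<exists>(Y :: nat monoid) (\<Gamma> :: nat set) \<psi>. shift_class Y \<Gamma> \<psi> \<and> comm_group Y \<and>
        shift_set Y \<Gamma> \<psi> > shift_alg Y \<Gamma> \<psi>) \<and>
     (\<exists>(Y :: nat monoid) (\<Gamma> :: nat set) \<psi>. shift_class Y \<Gamma> \<psi> \<and>
        shift_set Y \<Gamma> \<psi> > shift_cset Y \<Gamma> \<psi>)"
proof (intro conjI)
  show "\<forall>(Y :: ('y, 'b) monoid_scheme) (\<Gamma> :: 'i set) \<psi>. shift_class Y \<Gamma> \<psi> \<longrightarrow>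
        shift_top Y \<Gamma> \<psi> \<le> shift_cset Y \<Gamma> \<psi> \<and>
        shift_top Y \<Gamma> \<psi> \<le> shift_set Y \<Gamma> \<psi> \<and>
        (comm_group Y \<longrightarrow> shift_alg Y \<Gamma> \<psi> \<le> shift_set Y \<Gamma> \<psi>) \<and>
        shift_cset Y \<Gamma> \<psi> \<le> shift_set Y \<Gamma> \<psi> \<and>
        shift_top Y \<Gamma> \<psi> \<le> shift_top Y \<Gamma> \<psi> \<and>
        (comm_group Y \<longrightarrow> shift_alg Y \<Gamma> \<psi> \<le> shift_alg Y \<Gamma> \<psi>) \<and>
        shift_cset Y \<Gamma> \<psi> \<le> shift_cset Y \<Gamma> \<psi> \<and>
        shift_set Y \<Gamma> \<psi> \<le> shift_set Y \<Gamma> \<psi>"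
    by (intro allI impI conjI order_refl shift_top_le_cset shift_alg_le_set shift_cset_le_set
        order_trans [OF shift_top_le_cset shift_cset_le_set])
next
  have "shift_alg Z2 UNIV Suc < shift_top Z2 UNIV Suc"
    using shift_alg_Suc shift_top_Suc by (rule le_less_trans)
  moreover have "shift_alg Z2 UNIV Suc < shift_cset Z2 UNIV Suc"
    using calculation shift_top_le_cset [OF shift_class_Suc] by (rule less_le_trans)
  moreover have "shift_alg Z2 UNIV Suc < shift_set Z2 UNIV Suc"
    using calculation(2) shift_cset_le_set [OF shift_class_Suc] by (rule less_le_trans)
  ultimately show
    "\<exists>(Y :: nat monoid) (\<Gamma> :: nat set) \<psi>. shift_class Y \<Gamma> \<psi> \<and> comm_group Y \<and>
        shift_top Y \<Gamma> \<psi> > shift_alg Y \<Gamma> \<psi>"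
    "\<exists>(Y :: nat monoid) (\<Gamma> :: nat set) \<psi>. shift_class Y \<Gamma> \<psi> \<and> comm_group Y \<and>
        shift_cset Y \<Gamma> \<psi> > shift_alg Y \<Gamma> \<psi>"
    "\<exists>(Y :: nat monoid) (\<Gamma> :: nat set) \<psi>. shift_class Y \<Gamma> \<psi> \<and> comm_group Y \<and>
        shift_set Y \<Gamma> \<psi> > shift_alg Y \<Gamma> \<psi>"
    using shift_class_Suc comm_group_Z2 by blast+
next
  have "shift_top Z2 UNIV pred < shift_alg Z2 UNIV pred"
    using shift_top_pred shift_alg_pred by (rule le_less_trans)
  moreover have "shift_cset Z2 UNIV pred < shift_alg Z2 UNIV pred"
    using shift_cset_pred shift_alg_pred by (rule le_less_trans)
  moreover have "shift_top Z2 UNIV pred < shift_set Z2 UNIV pred"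
    using calculation(1) shift_alg_le_set [OF shift_class_pred] by (rule less_le_trans)
  moreover have "shift_cset Z2 UNIV pred < shift_set Z2 UNIV pred"
    using calculation(2) shift_alg_le_set [OF shift_class_pred] by (rule less_le_trans)
  ultimately show
    "\<exists>(Y :: nat monoid) (\<Gamma> :: nat set) \<psi>. shift_class Y \<Gamma> \<psi> \<and> comm_group Y \<and>
        shift_alg Y \<Gamma> \<psi> > shift_top Y \<Gamma> \<psi>"
    "\<exists>(Y :: nat monoid) (\<Gamma> :: nat set) \<psi>. shift_class Y \<Gamma> \<psi> \<and> comm_group Y \<and>
        shift_alg Y \<Gamma> \<psi> > shift_cset Y \<Gamma> \<psi>"
    "\<exists>(Y :: nat monoid) (\<Gamma> :: nat set) \<psi>. shift_class Y \<Gamma> \<psi> \<and>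
        shift_set Y \<Gamma> \<psi> > shift_top Y \<Gamma> \<psi>"
    "\<exists>(Y :: nat monoid) (\<Gamma> :: nat set) \<psi>. shift_class Y \<Gamma> \<psi> \<and>
        shift_set Y \<Gamma> \<psi> > shift_cset Y \<Gamma> \<psi>"
    using shift_class_pred comm_group_Z2 by blast+
next
  have "shift_top Z2 UNIV cycles < shift_cset Z2 UNIV cycles"
    using shift_top_cycles shift_cset_cycles by (rule le_less_trans)
  then show "\<exists>(Y :: nat monoid) (\<Gamma> :: nat set) \<psi>. shift_class Y \<Gamma> \<psi> \<and>
        shift_cset Y \<Gamma> \<psi> > shift_top Y \<Gamma> \<psi>"
    using shift_class_cycles by blast
qed

end
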